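(* Fix $\rho>0$. For any $\delta>0$, with probability at least $1-\delta$ over the draw of a sample $S$ of size $m$ (drawn i.i.d. from $\mathcal D$), the following holds for all $h\in\mathcal H$: $$R(h)\le R^{\mathrm{add}}_\rho(h)\le \widehat R^{\mathrm{add}}_{S,\rho}(h)+\frac{4\sqrt2}{\rho}\,\mathfrak R^G_m(\mathcal H)+M\sqrt{\frac{\log\frac1\delta}{2m}},$$ $$R(h)\le R^{\mathrm{mult}}_\rho(h)\le \widehat R^{\mathrm{mult}}_{S,\rho}(h)+\frac{4\sqrt2\,M}{\rho}\,\mathfrak R^G_m(\mathcal H)+M\sqrt{\frac{\log\frac1\delta}{2m}}.$$
   Context: Setting. $\mathcal X$ is an input space and $\mathcal Y$ an output space decomposing along substructures, $\mathcal Y=\mathcal Y_1\times\cdots\times\mathcal Y_l$. $\mathsf L:\mathcal Y\times\mathcal Y\to\mathbb R_+$ is a bounded loss that is definite ($\mathsf L(y,y')=0$ iff $y=y'$), and $M=\max_{y,y'}\mathsf L(y,y')$. $\mathcal D$ is a distribution over $\mathcal X\times\mathcal Y$ and $S=((x_1,y_1),\dots,(x_m,y_m))\sim\mathcal D^m$. $\mathcal H$ is a family of scoring functions $h:\mathcal X\times\mathcal Y\to\mathbb R$, with predictor $\mathsf h(x)=\operatorname{argmax}_{y\in\mathcal Y}h(x,y)$. Factor graphs. A factor graph is $G=(V,F,E)$ with variable nodes $V=\{1,\dots,l\}$, factor nodes $F$, and undirected edges $E$ between variable nodes and factor nodes. For $f\in F$, $\mathcal N(f)\subseteq V$ is the set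 of variable nodes adjacent to $f$, $\mathcal Y_f=\prod_{k\in\mathcal N(f)}\mathcal Y_k$, and $y_f\in\mathcal Y_f$ denotes the restriction of $y$ to $\mathcal N(f)$. The factor graph may depend on the example: $G_i=G(x_i,y_i)=([l_i],F_i,E_i)$. Every $h\in\mathcal H$ comes with a decomposition $h(x_i,y)=\sum_{f\in F_i}h_f(x_i,y_f)$ for all $y$. Complexity. $\widehat{\mathfrak R}^G_S(\mathcal H)=\frac1m\mathbb E_{\epsilon}\big[\sup_{h\in\mathcal H}\sum_{i=1}^m\sum_{f\in F_i}\sum_{y\in\mathcal Y_f}\sqrt{|F_i|}\,\epsilon_{i,f,y}\,h_f(x_i,y)\big]$, where the $\epsilon_{i,f,y}$ are independent uniform $\{\pm1\}$ variables, and $\mathfrak R^G_m(\mathcal H)=\mathbb E_{S\sim\mathcal D^m}[\widehat{\mathfrak R}^G_S(\mathcal H)]$. Errors. $R(h)=\mathbb E_{(x,y)\sim\mathcal D}[\mathsf L(\mathsf h(x),y)]$. With $\Phi^*(r)=\min(M,\max(0,r))$, $$R^{\mathrm{add}}_\rho(h)=\mathbb E_{(x,y)\sim\mathcal D}\Big[\Phi^*\Big(\max_{y'\ne y}\big\{\mathsf L(y',y)-\tfrac1\rho[h(x,y)-h(x,y')]\big\}\Big)\Big],$$ $$R^{\mathrm{mult}}_\rho(h)=\mathbb E_{(x,y)\sim\mathcal D}\Big[\Phi^*\Big(\max_{y'\ne y}\mathsf L(y',y)\big(1-\tfrac1\rho[h(x,y)-h(x,y')]\big)\Big)\Big],$$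 and $\widehat R^{\mathrm{add}}_{S,\rho}(h)$, $\widehat R^{\mathrm{mult}}_{S,\rho}(h)$ are the same quantities with $(x,y)$ drawn from the empirical distribution of $S$.
   Formalization: Each displayed line is shown to hold with probability at least 1-δ separately (jointly it can fail); suprema of weighted empirical sums of the margin losses over H are assumed measurable (else false); each Y_k is finite, and scores and predictors are measurable. *)

theory Defs
  imports "HOL-Probability.Probability"
begin

type_synonym 'v labelling = "nat \<Rightarrow> 'v"
type_synonym ('x, 'v) scorer = "'x \<Rightarrow> 'v labelling \<Rightarrow> real"

text \<open>Variable nodes are \<open>1, ..., num_vars G\<close>. An undirected edge between the variable
  node \<open>k\<close> and the factor node \<open>f\<close> is the pair \<open>(k, f)\<close>.\<close>

record 'f factor_graph =
  num_vars :: nat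
  factors :: "'f set"
  edges :: "(nat \<times> 'f) set"

text \<open>A graph attached to a single example may use fewer than the \<open>l\<close> substructures of the
  output space.\<close>

definition factor_graph_on :: "nat \<Rightarrow> 'f factor_graph \<Rightarrow> bool" where
  "factor_graph_on l G \<longleftrightarrow>
     num_vars G \<le> l \<and> finite (factors G) \<and> edges G \<subseteq> {1..num_vars G} \<times> factors G"

definition neighbours :: "'f factor_graph \<Rightarrow> 'f \<Rightarrow> nat set" where
  "neighbours G f = {k. (k, f) \<in> edges G}"

definition output_space :: "nat \<Rightarrow> (nat \<Rightarrow> 'v set) \<Rightarrow> 'v labelling set" where
  "output_space l Ys = (\<Pi>\<^sub>E k\<in>{1..l}. Ys k)"

definition factor_outputs ::
    "(nat \<Rightarrow> 'v set) \<Rightarrow> 'f factor_graph \<Rightarrow> 'f \<Rightarrow> 'v labelling set" where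
  "factor_outputs Ys G f = (\<Pi>\<^sub>E k\<in>neighbours G f. Ys k)"

text \<open>\<open>hf\<close> is the family of factor scores that comes with \<open>h\<close>; \<open>Gr (x, y)\<close> is the factor graph of
  the example \<open>(x, y)\<close>.\<close>

definition decomposes ::
    "'x set \<Rightarrow> 'v labelling set \<Rightarrow> ('x \<times> 'v labelling \<Rightarrow> 'f factor_graph) \<Rightarrow>
     ('x, 'v) scorer \<Rightarrow> ('f \<Rightarrow> 'x \<Rightarrow> 'v labelling \<Rightarrow> real) \<Rightarrow> bool" where
  "decomposes X Y Gr h hf \<longleftrightarrow>
     (\<forall>x\<in>X. \<forall>y\<in>Y. \<forall>y'\<in>Y.
        h x y' = (\<Sum>f\<in>factors (Gr (x, y)). hf f x (restrict y' (neighbours (Gr (x, y)) f))))"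


text \<open>The expectation of an extended-real random variable, as positive minus negative part. It
  allows the complexities below to be infinite.\<close>

definition eexpectation :: "'a measure \<Rightarrow> ('a \<Rightarrow> ereal) \<Rightarrow> ereal" where
  "eexpectation N f =
     enn2ereal (\<integral>\<^sup>+ w. e2ennreal (f w) \<partial>N) - enn2ereal (\<integral>\<^sup>+ w. e2ennreal (- f w) \<partial>N)"

definition rademacher_index ::
    "(nat \<Rightarrow> 'v set) \<Rightarrow> ('x \<times> 'v labelling \<Rightarrow> 'f factor_graph) \<Rightarrow> nat \<Rightarrow>
     (nat \<Rightarrow> 'x \<times> 'v labelling) \<Rightarrow> (nat \<times> 'f \<times> 'v labelling) set" where
  "rademacher_index Ys Gr m S =
     {(i, f, y). i < m \<and> f \<in> factors (Gr (S i)) \<and> y \<in> factor_outputs Ys (Gr (S i)) f}"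

definition empirical_fg_complexity ::
    "(nat \<Rightarrow> 'v set) \<Rightarrow> ('x \<times> 'v labelling \<Rightarrow> 'f factor_graph) \<Rightarrow>
     ('x, 'v) scorer set \<Rightarrow> (('x, 'v) scorer \<Rightarrow> 'f \<Rightarrow> 'x \<Rightarrow> 'v labelling \<Rightarrow> real) \<Rightarrow>
     nat \<Rightarrow> (nat \<Rightarrow> 'x \<times> 'v labelling) \<Rightarrow> ereal" where
  "empirical_fg_complexity Ys Gr H hf m S =
     ereal (1 / real m) *
     eexpectation
       (measure_pmf (Pi_pmf (rademacher_index Ys Gr m S) 0 (\<lambda>_. pmf_of_set {-1, 1 :: real})))
       (\<lambda>\<epsilon>. SUP h\<in>H. ereal
          (\<Sum>i<m. \<Sum>f\<in>factors (Gr (S i)). \<Sum>y\<in>factor_outputs Ys (Gr (S i)) f.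
             sqrt (real (card (factors (Gr (S i))))) * \<epsilon> (i, f, y) * hf h f (fst (S i)) y))"

text \<open>For nonempty \<open>H\<close> the empirical complexity is nonnegative. Where it is not measurable in
  the sample, the following is its lower integral.\<close>

definition fg_complexity ::
    "('x \<times> 'v labelling) measure \<Rightarrow>
     (nat \<Rightarrow> 'v set) \<Rightarrow> ('x \<times> 'v labelling \<Rightarrow> 'f factor_graph) \<Rightarrow>
     ('x, 'v) scorer set \<Rightarrow> (('x, 'v) scorer \<Rightarrow> 'f \<Rightarrow> 'x \<Rightarrow> 'v labelling \<Rightarrow> real) \<Rightarrow>
     nat \<Rightarrow> ereal" where
  "fg_complexity D Ys Gr H hf m =
     eexpectation (PiM {..<m} (\<lambda>_. D)) (empirical_fg_complexity Ys Gr H hf m)"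


definition max_loss :: "'y set \<Rightarrow> ('y \<Rightarrow> 'y \<Rightarrow> real) \<Rightarrow> real" where
  "max_loss Y L = Max {L y y' | y y'. y \<in> Y \<and> y' \<in> Y}"

definition clip :: "real \<Rightarrow> real \<Rightarrow> real" where
  "clip M r = min M (max 0 r)"

text \<open>If \<open>Y\<close> is a singleton, the maxima over \<open>Y - {y}\<close> are unspecified, but then
  \<open>max_loss Y L = 0\<close> and both margin losses are 0.\<close>

definition add_loss ::
    "'y set \<Rightarrow> ('y \<Rightarrow> 'y \<Rightarrow> real) \<Rightarrow> real \<Rightarrow> ('x \<Rightarrow> 'y \<Rightarrow> real) \<Rightarrow> 'x \<times> 'y \<Rightarrow> real" where
  "add_loss Y L \<rho> h = (\<lambda>(x, y). clip (max_loss Y L)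
     (Max ((\<lambda>y'. L y' y - (1 / \<rho>) * (h x y - h x y')) ` (Y - {y}))))"

definition mult_loss ::
    "'y set \<Rightarrow> ('y \<Rightarrow> 'y \<Rightarrow> real) \<Rightarrow> real \<Rightarrow> ('x \<Rightarrow> 'y \<Rightarrow> real) \<Rightarrow> 'x \<times> 'y \<Rightarrow> real" where
  "mult_loss Y L \<rho> h = (\<lambda>(x, y). clip (max_loss Y L)
     (Max ((\<lambda>y'. L y' y * (1 - (1 / \<rho>) * (h x y - h x y'))) ` (Y - {y}))))"

definition risk ::
    "('x \<times> 'y) measure \<Rightarrow> ('y \<Rightarrow> 'y \<Rightarrow> real) \<Rightarrow> ('x \<Rightarrow> 'y) \<Rightarrow> real" where
  "risk D L p = (\<integral>z. L (p (fst z)) (snd z) \<partial>D)"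

definition add_risk ::
    "('x \<times> 'y) measure \<Rightarrow> 'y set \<Rightarrow> ('y \<Rightarrow> 'y \<Rightarrow> real) \<Rightarrow> real \<Rightarrow> ('x \<Rightarrow> 'y \<Rightarrow> real) \<Rightarrow> real" where
  "add_risk D Y L \<rho> h = (\<integral>z. add_loss Y L \<rho> h z \<partial>D)"

definition mult_risk ::
    "('x \<times> 'y) measure \<Rightarrow> 'y set \<Rightarrow> ('y \<Rightarrow> 'y \<Rightarrow> real) \<Rightarrow> real \<Rightarrow> ('x \<Rightarrow> 'y \<Rightarrow> real) \<Rightarrow> real" where
  "mult_risk D Y L \<rho> h = (\<integral>z. mult_loss Y L \<rho> h z \<partial>D)"

definition empirical :: "nat \<Rightarrow> (nat \<Rightarrow> 'z) \<Rightarrow> 'z measure" where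
  "empirical m S = measure_pmf (map_pmf S (pmf_of_set {..<m}))"


text \<open>The usual measurability condition on a function class in empirical process theory
  (``\<open>P\<close>-measurable class'', here for one-sided suprema and without completing the product).
  For uncountable classes, uniform deviation bounds through symmetrisation can fail without a
  condition of this kind; countable and pointwise separable classes of measurable functions
  satisfy it.\<close>

definition sup_measurable :: "'z measure \<Rightarrow> ('z \<Rightarrow> real) set \<Rightarrow> bool" where
  "sup_measurable D F \<longleftrightarrow>
     (\<forall>n (e :: nat \<Rightarrow> real).
        (\<lambda>S. SUP g\<in>F. ereal (\<Sum>i<n. e i * g (S i))) \<in> borel_measurable (PiM {..<n} (\<lambda>_. D)))"

text \<open>Inner probability: the event \<open>P\<close> below quantifies over an uncountable class and need not be
  measurable. For a measurable event this says that its probability is at least \<open>p\<close>.\<close>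

definition holds_with_prob :: "'s measure \<Rightarrow> real \<Rightarrow> ('s \<Rightarrow> bool) \<Rightarrow> bool" where
  "holds_with_prob N p P \<longleftrightarrow> (\<exists>A\<in>sets N. measure N A \<ge> p \<and> (\<forall>S\<in>A. P S))"

end

theory Submission
  imports Defs
begin

text \<open>Both margin losses are Lipschitz in the score differences \<open>h x y - h x y'\<close>, hence, by
  Cauchy--Schwarz over the factors, in the Euclidean norm of the vector of all scaled factor scores
  \<open>sqrt (card F) * h\<^sub>f(x, u)\<close>. Maurer's vector contraction therefore bounds the empirical
  Rademacher complexity of the loss class by the factor graph complexity, and McDiarmid's inequality
  with symmetrisation bounds the deviation of the loss class. McDiarmid is applied not to
  \<open>SUP g. E g - avg g\<close>, which need not be measurable, but to its upper bound
  \<open>S \<mapsto> E\<^sub>S\<^sub>' (SUP g. avg\<^sub>S\<^sub>' g - avg\<^sub>S g)\<close> over an independent ghost sample.\<close>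

subsection \<open>Rademacher averages\<close>

text \<open>The constant \<open>4 * sqrt 2\<close> is the product of 2 from symmetrisation, 2 from
  the Khintchine inequality inside the contraction, and \<open>sqrt 2\<close> from writing score
  differences in factor scores. Two obstacles shape the rest. The condition
  \<open>sup_measurable\<close> covers only suprema of weighted sums over a finite sample, so every
  random supremum is brought into that form, and the signs stay fixed while the sample is
  integrated. The complexity, in turn, may be infinite and not measurable; it is only ever bounded
  below, sample by sample, by the Rademacher average of the loss class, which is bounded and
  integrable. Since a supremum over \<open>H\<close> need not be attained, the contraction is proved
  for finite classes with \<open>Max\<close>, and an arbitrary class is reached up to an error
  \<open>\<eta>\<close>.\<close>

definition rad_pmf :: "'a set \<Rightarrow> ('a \<Rightarrow> real) pmf" where
  "rad_pmf A = Pi_pmf A 0 (\<lambda>_. pmf_of_set {-1, 1})"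

abbreviation rad_exp :: "'a set \<Rightarrow> (('a \<Rightarrow> real) \<Rightarrow> real) \<Rightarrow> real" where
  "rad_exp A F \<equiv> measure_pmf.expectation (rad_pmf A) F"

lemma finite_set_rad_pmf:
  assumes "finite A"
  shows "finite (set_pmf (rad_pmf A))"
  unfolding rad_pmf_def using assms by (simp add: set_Pi_pmf finite_PiE_dflt)

text \<open>The support is finite, so averages over signs raise no integrability or measurability
  question, whatever \<open>F\<close> is.\<close>

lemma integrable_rad_pmf:
  fixes F :: "('a \<Rightarrow> real) \<Rightarrow> real"
  assumes "finite A"
  shows "integrable (rad_pmf A) F"
  using assms by (intro integrable_measure_pmf_finite finite_set_rad_pmf)

lemma rad_pmf_values:
  assumes "finite A" "e \<in> set_pmf (rad_pmf A)" "a \<in> A"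
  shows "e a = -1 \<or> e a = 1"
  using assms by (auto simp: rad_pmf_def set_Pi_pmf PiE_dflt_def)

lemma rad_exp_mono:
  assumes "finite A" "\<And>e. F e \<le> G e"
  shows "rad_exp A F \<le> rad_exp A G"
  using assms by (intro integral_mono integrable_rad_pmf)

lemma rad_exp_add:
  "finite A \<Longrightarrow> rad_exp A (\<lambda>e. F e + G e) = rad_exp A F + rad_exp A G"
  by (rule Bochner_Integration.integral_add) (auto intro: integrable_rad_pmf)

lemma rad_exp_empty: "rad_exp {} F = F (\<lambda>_. 0)"
  by (simp add: rad_pmf_def)

text \<open>Conditioning on the sign at \<open>a\<close>; the inductions over the index set of the
  signs rest on this recursion.\<close>

lemma rad_exp_insert:
  assumes "finite A" "a \<notin> A"
  shows "rad_exp (insert a A) F =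
    (rad_exp A (\<lambda>e. F (e(a := 1))) + rad_exp A (\<lambda>e. F (e(a := -1)))) / 2"
proof -
  have "rad_pmf (insert a A) =
      pmf_of_set {-1, 1} \<bind> (\<lambda>s. map_pmf (\<lambda>e. e(a := s)) (rad_pmf A))"
    unfolding rad_pmf_def using assms
    by (simp add: Pi_pmf_insert' map_pmf_def)
  also have "measure_pmf.expectation \<dots> F = (\<Sum>s\<in>{-1, 1}. pmf (pmf_of_set {-1, 1}) s *\<^sub>R
      measure_pmf.expectation (map_pmf (\<lambda>e. e(a := s)) (rad_pmf A)) F)"
    using assms by (intro pmf_expectation_bind) (auto intro: finite_set_rad_pmf)
  finally show ?thesis
    by (simp add: field_simps fun_upd_def)
qed

text \<open>Fubini for independent blocks of signs. The contraction needs it to join the fresh signs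
  of one example to those already introduced.\<close>

lemma rad_exp_union:
  assumes "finite A" "finite B" "A \<inter> B = {}"
  shows "rad_exp (A \<union> B) F = rad_exp A (\<lambda>e. rad_exp B (\<lambda>e'. F (\<lambda>x. if x \<in> B then e' x else e x)))"
  using assms(2,3)
proof (induction B arbitrary: F rule: finite_induct)
  case empty
  then show ?case by (simp add: rad_exp_empty)
next
  case (insert b B)
  have upd: "(\<lambda>x. if x \<in> B then e' x else e x)(b := s) =
      (\<lambda>x. if x \<in> insert b B then (e'(b := s)) x else e x)" for s :: real and e e' :: "'a \<Rightarrow> real"
    using insert.hyps by auto
  have "rad_exp (A \<union> insert b B) F = (rad_exp (A \<union> B) (\<lambda>e. F (e(b := 1)))
      + rad_exp (A \<union> B) (\<lambda>e. F (e(b := -1)))) / 2"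
    using insert assms(1) by (simp add: rad_exp_insert)
  also have "\<dots> = rad_exp A (\<lambda>e. (rad_exp B (\<lambda>e'. F (\<lambda>x. if x \<in> insert b B then (e'(b := 1)) x else e x))
      + rad_exp B (\<lambda>e'. F (\<lambda>x. if x \<in> insert b B then (e'(b := -1)) x else e x))) / 2)"
    using insert.IH[of "\<lambda>e. F (e(b := 1))"] insert.IH[of "\<lambda>e. F (e(b := -1))"] insert.prems assms(1)
    by (simp only: upd integral_divide_zero rad_exp_add[OF assms(1)]) auto
  also have "\<dots> = rad_exp A (\<lambda>e. rad_exp (insert b B) (\<lambda>e'. F (\<lambda>x. if x \<in> insert b B then e' x else e x)))"
    by (simp only: rad_exp_insert[OF insert.hyps])
  finally show ?case .
qed

text \<open>Negating all signs only exchanges the two branches of the recursion.\<close>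

lemma rad_exp_uminus:
  assumes "finite A"
  shows "rad_exp A (\<lambda>e. F (\<lambda>x. - e x)) = rad_exp A F"
  using assms
proof (induction A arbitrary: F rule: finite_induct)
  case empty
  then show ?case by (simp add: rad_exp_empty)
next
  case (insert a A)
  have upd: "(\<lambda>x. - (e(a := s)) x) = (\<lambda>x. - e x)(a := - s)" for e :: "'a \<Rightarrow> real" and s :: real
    by auto
  show ?case
    using insert.IH[of "\<lambda>e. F (e(a := 1))"] insert.IH[of "\<lambda>e. F (e(a := -1))"]
    by (simp only: rad_exp_insert[OF insert.hyps] upd) simp
qed

text \<open>By symmetry the average equals its own negative. This is what makes the Rademacher
  average of a nonempty class nonnegative.\<close>

lemma rad_exp_linear:
  assumes "finite A"
  shows "rad_exp A (\<lambda>e. \<Sum>a\<in>A. e a * v a) = 0"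
proof -
  have "rad_exp A (\<lambda>e. \<Sum>a\<in>A. e a * v a) = rad_exp A (\<lambda>e. - (\<Sum>a\<in>A. e a * v a))"
    using rad_exp_uminus[OF assms, of "\<lambda>e. \<Sum>a\<in>A. e a * v a"] by (simp add: sum_negf)
  then show ?thesis by simp
qed

section \<open>Moments of Rademacher sums\<close>

lemma sum_insert_upd:
  fixes e :: "'a \<Rightarrow> real"
  assumes "finite A" "a \<notin> A"
  shows "(\<Sum>b\<in>insert a A. (e(a := s)) b * v b) = s * v a + (\<Sum>b\<in>A. e b * v b)"
proof -
  have "(\<Sum>b\<in>A. (e(a := s)) b * v b) = (\<Sum>b\<in>A. e b * v b)"
    using assms by (intro sum.cong) auto
  then show ?thesis using assms by simp
qed

lemma rad_exp_square:
  assumes "finite A"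
  shows "rad_exp A (\<lambda>e. (\<Sum>a\<in>A. e a * v a)\<^sup>2) = (\<Sum>a\<in>A. (v a)\<^sup>2)"
  using assms
proof (induction A rule: finite_induct)
  case empty
  then show ?case by simp
next
  case (insert a A)
  let ?X = "\<lambda>e. \<Sum>b\<in>A. e b * v b"
  have "rad_exp (insert a A) (\<lambda>e. (\<Sum>b\<in>insert a A. e b * v b)\<^sup>2) =
      (rad_exp A (\<lambda>e. (1 * v a + ?X e)\<^sup>2) + rad_exp A (\<lambda>e. (- 1 * v a + ?X e)\<^sup>2)) / 2"
    by (simp only: rad_exp_insert[OF insert.hyps] sum_insert_upd[OF insert.hyps])
  also have "\<dots> = rad_exp A (\<lambda>e. ((v a + ?X e)\<^sup>2 + (- v a + ?X e)\<^sup>2) / 2)"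
    using insert.hyps by (simp add: rad_exp_add)
  also have "\<dots> = rad_exp A (\<lambda>e. (v a)\<^sup>2 + (?X e)\<^sup>2)"
    by (intro arg_cong[where f = "measure_pmf.expectation _"] ext) (simp add: power2_eq_square algebra_simps)
  finally show ?case using insert by (simp add: rad_exp_add)
qed

text \<open>Averaging over the new sign cancels the odd powers of \<open>v a\<close> and leaves
  \<open>(v a)^4 + 6 * (v a)^2 * X^2 + X^4\<close>. With the constant 3, the fourth moment of a
  standard Gaussian, the middle term is exactly the cross term of the new square, so the induction
  closes.\<close>

lemma rad_exp_fourth:
  assumes "finite A"
  shows "rad_exp A (\<lambda>e. (\<Sum>a\<in>A. e a * v a) ^ 4) \<le> 3 * (\<Sum>a\<in>A. (v a)\<^sup>2)\<^sup>2"
  using assms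
proof (induction A rule: finite_induct)
  case empty
  then show ?case by simp
next
  case (insert a A)
  let ?X = "\<lambda>e. \<Sum>b\<in>A. e b * v b"
  let ?V = "\<Sum>b\<in>A. (v b)\<^sup>2"
  have expand: "((v a + x) ^ 4 + (- v a + x) ^ 4) / 2 = ((v a) ^ 4 + 6 * (v a)\<^sup>2 * x\<^sup>2) + x ^ 4" for x
    by (simp add: power4_eq_xxxx power2_eq_square algebra_simps)
  have "rad_exp (insert a A) (\<lambda>e. (\<Sum>b\<in>insert a A. e b * v b) ^ 4) =
      (rad_exp A (\<lambda>e. (1 * v a + ?X e) ^ 4) + rad_exp A (\<lambda>e. (- 1 * v a + ?X e) ^ 4)) / 2"
    by (simp only: rad_exp_insert[OF insert.hyps] sum_insert_upd[OF insert.hyps])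
  also have "\<dots> = rad_exp A (\<lambda>e. ((v a + ?X e) ^ 4 + (- v a + ?X e) ^ 4) / 2)"
    using insert.hyps by (simp add: rad_exp_add)
  also have "\<dots> = (v a) ^ 4 + 6 * (v a)\<^sup>2 * ?V + rad_exp A (\<lambda>e. ?X e ^ 4)"
    unfolding expand using insert.hyps by (simp add: rad_exp_add rad_exp_square)
  also have "\<dots> \<le> (v a) ^ 4 + 6 * (v a)\<^sup>2 * ?V + 3 * ?V\<^sup>2"
    using insert.IH by simp
  also have "\<dots> \<le> 3 * ((v a)\<^sup>2 + ?V)\<^sup>2"
  proof -
    have "3 * ((v a)\<^sup>2 + ?V)\<^sup>2 = 3 * (v a) ^ 4 + 6 * (v a)\<^sup>2 * ?V + 3 * ?V\<^sup>2"
      by (simp add: power4_eq_xxxx power2_eq_square algebra_simps)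
    moreover have "0 \<le> (v a) ^ 4" by simp
    ultimately show ?thesis by linarith
  qed
  finally show ?case using insert.hyps by simp
qed

text \<open>The optimal constant is \<open>sqrt 2\<close> (Szarek); the fourth-moment method gives
  \<open>sqrt 3\<close>, and 2 suffices here.\<close>

lemma rademacher_khintchine:
  assumes "finite A"
  shows "sqrt (\<Sum>a\<in>A. (v a)\<^sup>2) \<le> 2 * rad_exp A (\<lambda>e. \<bar>\<Sum>a\<in>A. e a * v a\<bar>)"
proof (cases "(\<Sum>a\<in>A. (v a)\<^sup>2) = 0")
  case True
  moreover have "0 \<le> rad_exp A (\<lambda>e. \<bar>\<Sum>a\<in>A. e a * v a\<bar>)"
    by (intro integral_nonneg_AE) auto
  ultimately show ?thesis by simp
next
  case False
  define s where "s = sqrt (\<Sum>a\<in>A. (v a)\<^sup>2)"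
  have s2: "s\<^sup>2 = (\<Sum>a\<in>A. (v a)\<^sup>2)"
    unfolding s_def by (simp add: sum_nonneg)
  have s: "s > 0"
    using False by (simp add: s_def sum_nonneg order.not_eq_order_implies_strict)
  let ?X = "\<lambda>e. \<Sum>a\<in>A. e a * v a"
  \<comment> \<open>for \<open>t \<ge> 0\<close>, the bound is \<open>t (t - 2)\<^sup>2 (t + 4) \<ge> 0\<close> with \<open>t = \<bar>x\<bar> / s\<close>\<close>
  have pw: "3/4 * (1 / s) * x\<^sup>2 + (- 1/16 * (1 / s ^ 3)) * x ^ 4 \<le> \<bar>x\<bar>" for x
  proof -
    define t where "t = \<bar>x\<bar> / s"
    have t: "t \<ge> 0" "\<bar>x\<bar> = s * t" using s by (auto simp: t_def)
    have "0 \<le> s * (t * ((t - 2)\<^sup>2 * (t + 4)))" using t s by simp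
    then have "3/4 * (s * t\<^sup>2) - 1/16 * (s * t ^ 4) \<le> s * t"
      by (simp add: power2_eq_square power4_eq_xxxx algebra_simps)
    moreover have x2: "x\<^sup>2 = s\<^sup>2 * t\<^sup>2"
      using t(2) by (metis power2_abs power_mult_distrib)
    have x4: "x ^ 4 = (x\<^sup>2)\<^sup>2" by simp
    have "x ^ 4 = s ^ 3 * (s * t ^ 4)"
      unfolding x4 x2 by (simp add: power2_eq_square power4_eq_xxxx power3_eq_cube)
    then have "(- 1/16 * (1 / s ^ 3)) * x ^ 4 = - 1/16 * (s * t ^ 4)"
      using s by (simp del: power_mult_distrib)
    moreover have "3/4 * (1 / s) * x\<^sup>2 = 3/4 * (s * t\<^sup>2)"
      unfolding x2 using s by (simp add: power2_eq_square)
    ultimately show ?thesis using t by linarith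
  qed
  \<comment> \<open>The second moment \<open>s^2\<close> and a fourth moment of at most
    \<open>3 * s^4\<close> turn the polynomial minorant into
    \<open>3/4 * s - 3/16 * s = 9/16 * s\<close>, a little more than the half that is
    needed.\<close>
  have "1/2 * s \<le> 9/16 * s" using s by simp
  also have "\<dots> = 3/4 * (1 / s) * s\<^sup>2 + (- 1/16 * (1 / s ^ 3)) * (3 * (s\<^sup>2)\<^sup>2)"
    using s by (simp add: field_simps power2_eq_square power3_eq_cube)
  also have "\<dots> \<le> 3/4 * (1 / s) * s\<^sup>2 + (- 1/16 * (1 / s ^ 3)) * rad_exp A (\<lambda>e. ?X e ^ 4)"
    using rad_exp_fourth[OF assms, of v] s
    by (intro add_left_mono mult_left_mono_neg) (auto simp: s2)
  also have "\<dots> = rad_exp A (\<lambda>e. 3/4 * (1 / s) * (?X e)\<^sup>2 + (- 1/16 * (1 / s ^ 3)) * ?X e ^ 4)"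
    using assms by (simp only: rad_exp_add integral_mult_right_zero rad_exp_square s2)
  also have "\<dots> \<le> rad_exp A (\<lambda>e. \<bar>?X e\<bar>)"
    by (intro rad_exp_mono assms pw)
  finally show ?thesis by (simp add: s_def)
qed

text \<open>The two maxima are attained at possibly different points \<open>h1\<close> and
  \<open>h2\<close>, so \<open>\<psi>\<close> enters only through
  \<open>\<psi> h1 - \<psi> h2\<close>. The Lipschitz bound makes this a Euclidean norm, and
  Khintchine replaces the norm by an average over the signs on \<open>B\<close>, at the cost of the
  factor 2.\<close>

lemma rademacher_comparison_single:
  fixes \<psi> U :: "'h \<Rightarrow> real" and \<phi> :: "'b \<Rightarrow> 'h \<Rightarrow> real"
  assumes B: "finite B" and H: "finite H" "H \<noteq> {}"
    and lip: "\<And>h h'. h \<in> H \<Longrightarrow> h' \<in> H \<Longrightarrow> \<bar>\<psi> h - \<psi> h'\<bar> \<le> sqrt (\<Sum>b\<in>B. (\<phi> b h - \<phi> b h')\<^sup>2)"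
  shows "(Max ((\<lambda>h. U h + \<psi> h) ` H) + Max ((\<lambda>h. U h - \<psi> h) ` H)) / 2
    \<le> rad_exp B (\<lambda>e. Max ((\<lambda>h. U h + 2 * (\<Sum>b\<in>B. e b * \<phi> b h)) ` H))" (is "?L \<le> _")
proof -
  define Q where "Q = (\<lambda>e. Max ((\<lambda>h. U h + 2 * (\<Sum>b\<in>B. e b * \<phi> b h)) ` H))"
  have Max_att: "\<exists>h\<in>H. Max (f ` H) = f h" for f :: "'h \<Rightarrow> real"
  proof -
    have "Max (f ` H) \<in> f ` H" using H by (intro Max_in) auto
    then show ?thesis by (rule imageE) auto
  qed
  obtain h1 where h1: "h1 \<in> H" "Max ((\<lambda>h. U h + \<psi> h) ` H) = U h1 + \<psi> h1"
    using Max_att[of "\<lambda>h. U h + \<psi> h"] by blast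
  obtain h2 where h2: "h2 \<in> H" "Max ((\<lambda>h. U h - \<psi> h) ` H) = U h2 - \<psi> h2"
    using Max_att[of "\<lambda>h. U h - \<psi> h"] by blast
  let ?v = "\<lambda>b. \<phi> b h1 - \<phi> b h2"
  have Qge: "h \<in> H \<Longrightarrow> U h + 2 * (\<Sum>b\<in>B. e b * \<phi> b h) \<le> Q e" for h e
    unfolding Q_def using H by auto
  \<comment> \<open>\<open>h1\<close> is tested at one of \<open>e\<close> and \<open>- e\<close>,
    and \<open>h2\<close> at the other; the two choices give both signs of the sum, hence its
    absolute value.\<close>
  have pw: "U h1 + U h2 + 2 * \<bar>\<Sum>b\<in>B. e b * ?v b\<bar> \<le> Q e + Q (\<lambda>b. - e b)" for e
    using Qge[OF h1(1), of e] Qge[OF h1(1), of "\<lambda>b. - e b"] Qge[OF h2(1), of e] Qge[OF h2(1), of "\<lambda>b. - e b"]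
    by (auto simp: right_diff_distrib sum_subtractf sum_negf abs_if)
  have "2 * ?L \<le> U h1 + U h2 + sqrt (\<Sum>b\<in>B. (?v b)\<^sup>2)"
    using lip[OF h1(1) h2(1)] h1 h2 by simp
  also have "\<dots> \<le> U h1 + U h2 + 2 * rad_exp B (\<lambda>e. \<bar>\<Sum>b\<in>B. e b * ?v b\<bar>)"
    using rademacher_khintchine[OF B, of ?v] by simp
  also have "\<dots> = rad_exp B (\<lambda>e. U h1 + U h2 + 2 * \<bar>\<Sum>b\<in>B. e b * ?v b\<bar>)"
    using B by (simp add: rad_exp_add)
  also have "\<dots> \<le> rad_exp B (\<lambda>e. Q e + Q (\<lambda>b. - e b))"
    by (intro rad_exp_mono B pw)
  also have "\<dots> = 2 * rad_exp B Q"
    using B rad_exp_uminus[OF B, of Q] by (simp add: rad_exp_add)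
  finally show ?thesis by (simp add: Q_def)
qed

text \<open>Maurer's vector contraction inequality, one coordinate of the left-hand side at a time.\<close>

lemma rademacher_comparison:
  fixes \<psi> :: "'i \<Rightarrow> 'h \<Rightarrow> real" and \<phi> :: "'b \<Rightarrow> 'h \<Rightarrow> real"
  assumes I: "finite I" and B: "\<And>i. i \<in> I \<Longrightarrow> finite (B i)" "disjoint_family_on B I"
    and H: "finite H" "H \<noteq> {}"
    and lip: "\<And>i h h'. i \<in> I \<Longrightarrow> h \<in> H \<Longrightarrow> h' \<in> H \<Longrightarrow>
      \<bar>\<psi> i h - \<psi> i h'\<bar> \<le> sqrt (\<Sum>b\<in>B i. (\<phi> b h - \<phi> b h')\<^sup>2)"
  shows "rad_exp I (\<lambda>e. Max ((\<lambda>h. U h + (\<Sum>i\<in>I. e i * \<psi> i h)) ` H))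
    \<le> rad_exp (\<Union>i\<in>I. B i) (\<lambda>e. Max ((\<lambda>h. U h + 2 * (\<Sum>b\<in>(\<Union>i\<in>I. B i). e b * \<phi> b h)) ` H))"
  using I B lip
proof (induction I arbitrary: U rule: finite_induct)
  case empty
  then show ?case by (simp add: rad_exp_empty)
next
  case (insert j I)
  let ?A = "\<Union>i\<in>I. B i"
  have disj: "?A \<inter> B j = {}"
    using insert.prems(2) insert.hyps by (fastforce simp: disjoint_family_on_def)
  have finA: "finite ?A" "finite (B j)" using insert by auto
  \<comment> \<open>\<open>U\<close> must stay arbitrary: it absorbs \<open>\<psi> j\<close> with
    either sign while the other coordinates are replaced, and afterwards it is joined by their
    replaced sum while \<open>j\<close> itself is treated.\<close>
  have IH: "rad_exp I (\<lambda>e. Max ((\<lambda>h. U h + (\<Sum>i\<in>I. e i * \<psi> i h)) ` H))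
    \<le> rad_exp ?A (\<lambda>e. Max ((\<lambda>h. U h + 2 * (\<Sum>b\<in>?A. e b * \<phi> b h)) ` H))" for U
    using insert.prems by (intro insert.IH) (auto simp: disjoint_family_on_def)
  have split: "(\<Sum>b\<in>?A \<union> B j. (if b \<in> B j then e' b else e b) * \<phi> b h) =
      (\<Sum>b\<in>?A. e b * \<phi> b h) + (\<Sum>b\<in>B j. e' b * \<phi> b h)" for e e' :: "'b \<Rightarrow> real" and h
  proof -
    have "(\<Sum>b\<in>?A. (if b \<in> B j then e' b else e b) * \<phi> b h) = (\<Sum>b\<in>?A. e b * \<phi> b h)"
      using disj by (intro sum.cong) auto
    then show ?thesis using disj finA by (subst sum.union_disjoint) auto
  qed
  have "rad_exp (insert j I) (\<lambda>e. Max ((\<lambda>h. U h + (\<Sum>i\<in>insert j I. e i * \<psi> i h)) ` H)) =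
     (rad_exp I (\<lambda>e. Max ((\<lambda>h. (U h + \<psi> j h) + (\<Sum>i\<in>I. e i * \<psi> i h)) ` H)) +
      rad_exp I (\<lambda>e. Max ((\<lambda>h. (U h - \<psi> j h) + (\<Sum>i\<in>I. e i * \<psi> i h)) ` H))) / 2"
    by (simp only: rad_exp_insert[OF insert.hyps] sum_insert_upd[OF insert.hyps]) (simp add: algebra_simps)
  also have "\<dots> \<le> (rad_exp ?A (\<lambda>e. Max ((\<lambda>h. (U h + \<psi> j h) + 2 * (\<Sum>b\<in>?A. e b * \<phi> b h)) ` H)) +
      rad_exp ?A (\<lambda>e. Max ((\<lambda>h. (U h - \<psi> j h) + 2 * (\<Sum>b\<in>?A. e b * \<phi> b h)) ` H))) / 2"
    by (intro divide_right_mono add_mono IH) auto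
  also have "\<dots> = rad_exp ?A (\<lambda>e.
      (Max ((\<lambda>h. (U h + 2 * (\<Sum>b\<in>?A. e b * \<phi> b h)) + \<psi> j h) ` H) +
       Max ((\<lambda>h. (U h + 2 * (\<Sum>b\<in>?A. e b * \<phi> b h)) - \<psi> j h) ` H)) / 2)"
    using finA by (simp add: rad_exp_add algebra_simps)
  also have "\<dots> \<le> rad_exp ?A (\<lambda>e. rad_exp (B j) (\<lambda>e'.
      Max ((\<lambda>h. (U h + 2 * (\<Sum>b\<in>?A. e b * \<phi> b h)) + 2 * (\<Sum>b\<in>B j. e' b * \<phi> b h)) ` H)))"
    using finA H insert.prems by (intro rad_exp_mono rademacher_comparison_single) auto
  also have "\<dots> = rad_exp (?A \<union> B j) (\<lambda>e. Max ((\<lambda>h. U h + 2 * (\<Sum>b\<in>?A \<union> B j. e b * \<phi> b h)) ` H))"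
    using finA disj by (simp only: rad_exp_union split) (simp add: algebra_simps)
  also have "?A \<union> B j = (\<Union>i\<in>insert j I. B i)" by auto
  finally show ?case .
qed

subsection \<open>McDiarmid's inequality\<close>

text \<open>Bounded differences control only the width of the conditional range; its position varies
  with the coordinates held fixed. The infimum over the space supplies the missing left
  endpoint.\<close>

lemma (in prob_space) Hoeffdings_lemma_width:
  assumes f[measurable]: "f \<in> borel_measurable M"
    and width: "\<And>x y. x \<in> space M \<Longrightarrow> y \<in> space M \<Longrightarrow> f x - f y \<le> c"
    and s: "s > 0"
  shows "(\<integral>\<^sup>+x. exp (s * (f x - expectation f)) \<partial>M) \<le> ennreal (exp (s\<^sup>2 * c\<^sup>2 / 8))"
proof -
  obtain x0 where x0: "x0 \<in> space M" using not_empty by auto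
  define a where "a = (INF x\<in>space M. f x)"
  have bdd: "bdd_below (f ` space M)"
    using width[OF x0] by (intro bdd_belowI2[of _ "f x0 - c"]) (auto simp: algebra_simps)
  have lower: "a \<le> f x" if "x \<in> space M" for x
    unfolding a_def using bdd that by (rule cINF_lower)
  have upper: "f x \<le> a + c" if "x \<in> space M" for x
  proof -
    have "f x - c \<le> a"
      unfolding a_def using x0 width[OF that] by (intro cINF_greatest) (auto simp: algebra_simps)
    then show ?thesis by simp
  qed
  interpret interval_bounded_random_variable M f a "a + c"
    using lower upper by unfold_locales auto
  show ?thesis
    using Hoeffdings_lemma_nn_integral[OF s] by simp
qed

text \<open>The martingale argument: integrate out one coordinate, whose conditional fluctuation is
  controlled by Hoeffding's lemma; the remaining average again has bounded differences.\<close>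

lemma McDiarmid_mgf:
  fixes D :: "'z measure" and f :: "(nat \<Rightarrow> 'z) \<Rightarrow> real"
  assumes D: "prob_space D"
    and f: "f \<in> borel_measurable (PiM {..<n} (\<lambda>_. D))"
    and bound: "\<And>S. S \<in> space (PiM {..<n} (\<lambda>_. D)) \<Longrightarrow> \<bar>f S\<bar> \<le> K"
    and diff: "\<And>S i z. S \<in> space (PiM {..<n} (\<lambda>_. D)) \<Longrightarrow> i < n \<Longrightarrow> z \<in> space D \<Longrightarrow> f (S(i := z)) - f S \<le> c"
    and s: "s > 0"
  shows "(\<integral>\<^sup>+S. exp (s * (f S - (\<integral>S. f S \<partial>PiM {..<n} (\<lambda>_. D)))) \<partial>PiM {..<n} (\<lambda>_. D))
    \<le> ennreal (exp (real n * (s\<^sup>2 * c\<^sup>2 / 8)))"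
  using f bound diff
proof (induction n arbitrary: f)
  case 0
  interpret P: prob_space "PiM {..<0::nat} (\<lambda>_. D)"
    using D by (intro prob_space_PiM) auto
  have "(\<integral>S. f S \<partial>PiM {..<0::nat} (\<lambda>_. D)) = f (\<lambda>_. undefined)"
    by (simp add: PiM_empty lebesgue_integral_count_space_finite)
  then show ?case
    by (simp add: PiM_empty nn_integral_count_space_finite)
next
  case (Suc n)
  interpret D: prob_space D by fact
  interpret PF: product_prob_space "\<lambda>_::nat. D" by standard
  let ?P = "PiM {..<n} (\<lambda>_. D)" and ?Q = "PiM {..<Suc n} (\<lambda>_. D)"
  interpret P: prob_space ?P using D by (intro prob_space_PiM) auto
  interpret Q: prob_space ?Q using D by (intro prob_space_PiM) auto
  have Q: "?Q = PiM (insert n {..<n}) (\<lambda>_. D)" by (simp add: lessThan_Suc)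
  note f[measurable] = Suc.prems(1)
  have upd: "S(n := z) \<in> space ?Q" if "S \<in> space ?P" "z \<in> space D" for S z
    using that by (auto simp: space_PiM PiE_def extensional_def Pi_def less_Suc_eq)
  have upd_meas[measurable]: "(\<lambda>(S, z). S(n := z)) \<in> ?P \<Otimes>\<^sub>M D \<rightarrow>\<^sub>M ?Q"
    unfolding Q by (rule measurable_add_dim)
  have f2[measurable]: "(\<lambda>(S, z). f (S(n := z))) \<in> borel_measurable (?P \<Otimes>\<^sub>M D)"
    using measurable_compose[OF upd_meas f] by (simp add: case_prod_beta')
  have fS[measurable]: "(\<lambda>z. f (S(n := z))) \<in> borel_measurable D" if "S \<in> space ?P" for S
    using measurable_compose_Pair1[OF that f2] by simp
  define g where "g S = (\<integral>z. f (S(n := z)) \<partial>D)" for S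
  have g[measurable]: "g \<in> borel_measurable ?P"
    unfolding g_def by (rule D.borel_measurable_lebesgue_integral[OF f2])
  have intf: "integrable ?Q f"
    using Suc.prems(2) by (intro Q.integrable_const_bound[of _ K]) auto
  have intS: "integrable D (\<lambda>z. f (S(n := z)))" if "S \<in> space ?P" for S
    using Suc.prems(2) upd[OF that] that by (intro D.integrable_const_bound[of _ K]) auto
  have Ef: "(\<integral>S. f S \<partial>?Q) = (\<integral>S. g S \<partial>?P)"
    unfolding g_def using intf unfolding Q by (subst PF.product_integral_insert) auto
  have bg: "\<bar>g S\<bar> \<le> K" if "S \<in> space ?P" for S
  proof -
    have "\<bar>g S\<bar> \<le> (\<integral>z. \<bar>f (S(n := z))\<bar> \<partial>D)"
      unfolding g_def by (rule integral_abs_bound)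
    also have "\<dots> \<le> (\<integral>z. K \<partial>D)"
      using intS[OF that] Suc.prems(2) upd[OF that] by (intro integral_mono) auto
    finally show ?thesis by (simp add: D.prob_space)
  qed
  have dg: "g (S(i := z)) - g S \<le> c" if S: "S \<in> space ?P" and i: "i < n" and z: "z \<in> space D" for S i z
  proof -
    have S': "S(i := z) \<in> space ?P"
      using S i z by (auto simp: space_PiM PiE_def extensional_def Pi_def)
    have "g (S(i := z)) - g S = (\<integral>w. f (S(i := z, n := w)) - f (S(n := w)) \<partial>D)"
      unfolding g_def by (rule Bochner_Integration.integral_diff[symmetric]) (intro intS S S')+
    also have "\<dots> \<le> (\<integral>w. c \<partial>D)"
    proof (intro integral_mono Bochner_Integration.integrable_diff intS S S' D.integrable_const)
      fix w assume w: "w \<in> space D"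
      have *: "S(i := z, n := w) = (S(n := w))(i := z)" using i by (auto simp: fun_upd_twist)
      show "f (S(i := z, n := w)) - f (S(n := w)) \<le> c"
        unfolding * using i by (intro Suc.prems(3) upd S w z) auto
    qed
    finally show ?thesis by (simp add: D.prob_space)
  qed
  \<comment> \<open>The two arguments differ in coordinate \<open>n\<close> alone, so the difference
    bound is the width that Hoeffding's lemma asks for.\<close>
  have wid: "f (S(n := z)) - f (S(n := w)) \<le> c" if "S \<in> space ?P" "z \<in> space D" "w \<in> space D" for S z w
    using Suc.prems(3)[OF upd[OF that(1,3)] lessI that(2)] by (simp only: fun_upd_upd)
  let ?h = "s\<^sup>2 * c\<^sup>2 / 8" and ?E = "(\<integral>S. f S \<partial>?Q)"
  have "(\<integral>\<^sup>+S. exp (s * (f S - ?E)) \<partial>?Q) = (\<integral>\<^sup>+S. (\<integral>\<^sup>+z. exp (s * (f (S(n := z)) - ?E)) \<partial>D) \<partial>?P)"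
    unfolding Q by (rule PF.product_nn_integral_insert) (use Q in \<open>auto simp flip: Q\<close>)
  also have "\<dots> \<le> (\<integral>\<^sup>+S. ennreal (exp ?h) * ennreal (exp (s * (g S - (\<integral>S. g S \<partial>?P)))) \<partial>?P)"
  proof (rule nn_integral_mono)
    fix S assume S: "S \<in> space ?P"
    \<comment> \<open>The exponent is split at the conditional mean \<open>g S\<close>: Hoeffding's
      lemma handles the first part, and the second is constant in \<open>z\<close>.\<close>
    have "(\<integral>\<^sup>+z. exp (s * (f (S(n := z)) - ?E)) \<partial>D) =
        (\<integral>\<^sup>+z. ennreal (exp (s * (f (S(n := z)) - g S))) * ennreal (exp (s * (g S - ?E))) \<partial>D)"
      by (simp flip: ennreal_mult' exp_add add: algebra_simps)
    also have "\<dots> = (\<integral>\<^sup>+z. ennreal (exp (s * (f (S(n := z)) - g S))) \<partial>D) * ennreal (exp (s * (g S - ?E)))"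
      using fS[OF S] by (intro nn_integral_multc) auto
    also have "\<dots> \<le> ennreal (exp ?h) * ennreal (exp (s * (g S - ?E)))"
      unfolding g_def using wid[OF S] fS[OF S]
      by (intro mult_right_mono D.Hoeffdings_lemma_width s) auto
    finally show "(\<integral>\<^sup>+z. exp (s * (f (S(n := z)) - ?E)) \<partial>D)
        \<le> ennreal (exp ?h) * ennreal (exp (s * (g S - (\<integral>S. g S \<partial>?P))))"
      by (simp add: Ef)
  qed
  also have "\<dots> = ennreal (exp ?h) * (\<integral>\<^sup>+S. ennreal (exp (s * (g S - (\<integral>S. g S \<partial>?P)))) \<partial>?P)"
    by (rule nn_integral_cmult) measurable
  also have "\<dots> \<le> ennreal (exp ?h) * ennreal (exp (real n * ?h))"
    by (intro mult_left_mono Suc.IH g bg dg) auto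
  also have "\<dots> = ennreal (exp (real (Suc n) * ?h))"
    by (simp flip: ennreal_mult' exp_add add: algebra_simps)
  finally show ?case .
qed

text \<open>Chernoff's method. A one-sided difference bound for every \<open>S\<close> is already
  two-sided, since moving the coordinate back exchanges the two values.\<close>

theorem McDiarmid:
  fixes D :: "'z measure" and f :: "(nat \<Rightarrow> 'z) \<Rightarrow> real"
  assumes D: "prob_space D"
    and f[measurable]: "f \<in> borel_measurable (PiM {..<n} (\<lambda>_. D))"
    and bound: "\<And>S. S \<in> space (PiM {..<n} (\<lambda>_. D)) \<Longrightarrow> \<bar>f S\<bar> \<le> K"
    and diff: "\<And>S i z. S \<in> space (PiM {..<n} (\<lambda>_. D)) \<Longrightarrow> i < n \<Longrightarrow> z \<in> space D \<Longrightarrow> f (S(i := z)) - f S \<le> c"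
    and t: "t > 0" and c: "c > 0" and n: "n > 0"
  shows "measure (PiM {..<n} (\<lambda>_. D))
      {S \<in> space (PiM {..<n} (\<lambda>_. D)). f S - (\<integral>S. f S \<partial>PiM {..<n} (\<lambda>_. D)) \<ge> t}
    \<le> exp (- 2 * t\<^sup>2 / (real n * c\<^sup>2))"
proof -
  let ?P = "PiM {..<n} (\<lambda>_. D)"
  let ?E = "\<integral>S. f S \<partial>?P"
  interpret P: prob_space ?P using D by (intro prob_space_PiM) auto
  \<comment> \<open>Minimises the exponent \<open>- s * t + n * s^2 * c^2 / 8\<close>.\<close>
  define s where "s = 4 * t / (real n * c\<^sup>2)"
  have s: "s > 0" unfolding s_def using t c n by simp
  have "emeasure ?P {S \<in> space ?P. f S - ?E \<ge> t}
      \<le> ennreal (exp (- s * t)) * (\<integral>\<^sup>+S. ennreal (exp (s * (f S - ?E))) * indicator (space ?P) S \<partial>?P)"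
    by (rule Chernoff_ineq_nn_integral_ge) (use s in auto)
  also have "(\<integral>\<^sup>+S. ennreal (exp (s * (f S - ?E))) * indicator (space ?P) S \<partial>?P) =
      (\<integral>\<^sup>+S. exp (s * (f S - ?E)) \<partial>?P)"
    by (intro nn_integral_cong) auto
  also have "ennreal (exp (- s * t)) * \<dots> \<le> ennreal (exp (- s * t)) * ennreal (exp (real n * (s\<^sup>2 * c\<^sup>2 / 8)))"
    using McDiarmid_mgf[OF D f bound diff s] by (intro mult_left_mono) auto
  also have "\<dots> = ennreal (exp (- s * t + real n * (s\<^sup>2 * c\<^sup>2 / 8)))"
    by (simp flip: ennreal_mult' exp_add)
  also have "- s * t + real n * (s\<^sup>2 * c\<^sup>2 / 8) = - 2 * t\<^sup>2 / (real n * c\<^sup>2)"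
    unfolding s_def using n c by (simp add: field_simps power2_eq_square)
  finally show ?thesis by (simp add: P.emeasure_eq_measure)
qed

subsection \<open>Symmetrisation\<close>

lemma rad_exp_integral:
  fixes f :: "('i \<Rightarrow> real) \<Rightarrow> 'a \<Rightarrow> real"
  assumes A: "finite A" and f: "\<And>e. integrable M (f e)"
  shows "integrable M (\<lambda>x. rad_exp A (\<lambda>e. f e x))"
    and "(\<integral>x. rad_exp A (\<lambda>e. f e x) \<partial>M) = rad_exp A (\<lambda>e. \<integral>x. f e x \<partial>M)"
proof -
  have *: "rad_exp A h = (\<Sum>e\<in>set_pmf (rad_pmf A). h e * pmf (rad_pmf A) e)" for h
    using finite_set_rad_pmf[OF A] by (intro integral_measure_pmf_real) auto
  show "integrable M (\<lambda>x. rad_exp A (\<lambda>e. f e x))"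
    unfolding * using f by auto
  show "(\<integral>x. rad_exp A (\<lambda>e. f e x) \<partial>M) = rad_exp A (\<lambda>e. \<integral>x. f e x \<partial>M)"
    unfolding * using f by simp
qed

lemma sum_lessThan_double:
  fixes f :: "nat \<Rightarrow> 'a::comm_monoid_add"
  shows "(\<Sum>i<2 * m. f i) = (\<Sum>i<m. f i + f (m + i))"
proof -
  have "(+) m ` {..<m} = {m..<m + m}"
    using image_add_atLeastLessThan[of m 0 m] by (simp add: lessThan_atLeast0 add.commute)
  then have "{..<2 * m} = {..<m} \<union> (+) m ` {..<m}"
    by auto
  moreover have "{..<m} \<inter> (+) m ` {..<m} = {}" by auto
  ultimately show ?thesis
    by (simp add: sum.union_disjoint sum.reindex sum.distrib)
qed

text \<open>The range conditions hold at every point of the type, not only on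
  \<open>space D\<close>, so suprema over the class are bounded at arbitrary \<open>S\<close>.
  Clipped losses have this property.\<close>

locale bounded_class = D: prob_space D for D :: "'z measure" +
  fixes F :: "('z \<Rightarrow> real) set" and M :: real
  assumes F_ne: "F \<noteq> {}"
    and F_meas: "\<And>g. g \<in> F \<Longrightarrow> g \<in> borel_measurable D"
    and F_nonneg: "\<And>g z. g \<in> F \<Longrightarrow> 0 \<le> g z"
    and F_le: "\<And>g z. g \<in> F \<Longrightarrow> g z \<le> M"
    and F_sup: "sup_measurable D F"
begin

text \<open>Arbitrary real weights let one function serve both the sign averages and the difference
  between ghost and true sample.\<close>

definition class_sup :: "nat \<Rightarrow> (nat \<Rightarrow> real) \<Rightarrow> (nat \<Rightarrow> 'z) \<Rightarrow> real" where
  "class_sup n e S = (SUP g\<in>F. \<Sum>i<n. e i * g (S i))"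

abbreviation samples :: "nat set \<Rightarrow> (nat \<Rightarrow> 'z) measure" where
  "samples I \<equiv> PiM I (\<lambda>_. D)"

sublocale PF: product_prob_space "\<lambda>_::nat. D" ..

lemma prob_space_samples: "prob_space (samples I)"
  by (rule prob_space_PiM) unfold_locales

lemma M_nonneg: "0 \<le> M"
  using F_ne F_nonneg F_le order_trans by blast

lemma weighted_sum_bound:
  assumes "g \<in> F"
  shows "\<bar>\<Sum>i<n. e i * g (S i)\<bar> \<le> (\<Sum>i<n. \<bar>e i\<bar>) * M"
proof -
  have "\<bar>\<Sum>i<n. e i * g (S i)\<bar> \<le> (\<Sum>i<n. \<bar>e i\<bar> * M)"
    using F_nonneg[OF assms] F_le[OF assms]
    by (intro order_trans[OF sum_abs] sum_mono) (simp add: abs_mult mult_left_mono)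
  then show ?thesis by (simp add: sum_distrib_right)
qed

lemma bdd_above_class: "bdd_above ((\<lambda>g. \<Sum>i<n. e i * g (S i)) ` F)"
  using weighted_sum_bound[of _ e S n] by (intro bdd_aboveI2[of _ _ "(\<Sum>i<n. \<bar>e i\<bar>) * M"]) (auto simp: abs_le_iff)

lemma class_sup_upper: "g \<in> F \<Longrightarrow> (\<Sum>i<n. e i * g (S i)) \<le> class_sup n e S"
  unfolding class_sup_def by (rule cSUP_upper[OF _ bdd_above_class])

lemma class_sup_least: "(\<And>g. g \<in> F \<Longrightarrow> (\<Sum>i<n. e i * g (S i)) \<le> b) \<Longrightarrow> class_sup n e S \<le> b"
  unfolding class_sup_def using F_ne by (rule cSUP_least)

lemma class_sup_bound: "\<bar>class_sup n e S\<bar> \<le> (\<Sum>i<n. \<bar>e i\<bar>) * M"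
proof -
  obtain g where g: "g \<in> F" using F_ne by auto
  have "class_sup n e S \<le> (\<Sum>i<n. \<bar>e i\<bar>) * M"
    using weighted_sum_bound by (intro class_sup_least) (auto simp: abs_le_iff)
  moreover have "- ((\<Sum>i<n. \<bar>e i\<bar>) * M) \<le> class_sup n e S"
    using class_sup_upper[OF g, of e S n] weighted_sum_bound[OF g, of e S n] by linarith
  ultimately show ?thesis by linarith
qed

text \<open>Transfers \<open>sup_measurable\<close>, which speaks of extended-real suprema, to real
  ones.\<close>

lemma ereal_class_sup: "ereal (class_sup n e S) = (SUP g\<in>F. ereal (\<Sum>i<n. e i * g (S i)))"
proof -
  let ?s = "SUP g\<in>F. ereal (\<Sum>i<n. e i * g (S i))"
  obtain g where g: "g \<in> F" using F_ne by auto
  have "?s \<le> ereal (class_sup n e S)"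
    by (intro SUP_least) (simp add: class_sup_upper)
  moreover have "ereal (\<Sum>i<n. e i * g (S i)) \<le> ?s"
    by (rule SUP_upper[OF g])
  ultimately have "\<bar>?s\<bar> \<noteq> \<infinity>"
    by (cases ?s) auto
  then show ?thesis
    unfolding class_sup_def by (rule ereal_SUP)
qed

lemma class_sup_measurable[measurable]: "class_sup n e \<in> borel_measurable (samples {..<n})"
proof -
  have "(\<lambda>S. ereal (class_sup n e S)) \<in> borel_measurable (samples {..<n})"
    unfolding ereal_class_sup using F_sup by (simp add: sup_measurable_def)
  then have "(\<lambda>S. real_of_ereal (ereal (class_sup n e S))) \<in> borel_measurable (samples {..<n})"
    by (rule borel_measurable_real_of_ereal)
  then show ?thesis by simp
qed

lemma class_sup_integrable: "integrable (samples {..<n}) (class_sup n e)"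
proof -
  interpret P: prob_space "samples {..<n}" by (rule prob_space_samples)
  show ?thesis
    using class_sup_bound by (intro P.integrable_const_bound[of _ "(\<Sum>i<n. \<bar>e i\<bar>) * M"]) auto
qed

lemma class_sup_cong: "(\<And>i. i < n \<Longrightarrow> S i = T i) \<Longrightarrow> class_sup n e S = class_sup n e T"
  unfolding class_sup_def by simp

text \<open>Injectively chosen coordinates of an i.i.d. sample form an i.i.d. sample. This serves
  twice: for permutations of the double sample and for its two halves.\<close>

lemma class_sup_reindex:
  assumes p: "inj_on p {..<n}" "p \<in> {..<n} \<rightarrow> {..<N}"
  shows "integrable (samples {..<N}) (\<lambda>T. class_sup n e (\<lambda>i. T (p i)))"
    and "(\<integral>T. class_sup n e (\<lambda>i. T (p i)) \<partial>samples {..<N}) = (\<integral>S. class_sup n e S \<partial>samples {..<n})"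
proof -
  \<comment> \<open>Points of a product space are undefined off the index set, hence the
    restriction; \<open>class_sup n\<close> does not see it.\<close>
  let ?t = "\<lambda>\<omega>. \<lambda>i\<in>{..<n}. \<omega> (p i)"
  have d: "distr (samples {..<N}) (samples {..<n}) ?t = samples {..<n}"
    using distr_PiM_reindex[of "{..<N}" "\<lambda>_. D" p "{..<n}"] p D.prob_space_axioms by simp
  have t: "?t \<in> samples {..<N} \<rightarrow>\<^sub>M samples {..<n}"
    using p by (intro measurable_restrict measurable_component_singleton) auto
  have c: "class_sup n e (?t T) = class_sup n e (\<lambda>i. T (p i))" for T
    by (rule class_sup_cong) simp
  show "integrable (samples {..<N}) (\<lambda>T. class_sup n e (\<lambda>i. T (p i)))"
    using class_sup_integrable[of n e] unfolding c[symmetric]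
    by (subst integrable_distr_eq[OF t, symmetric]) (auto simp: d)
  show "(\<integral>T. class_sup n e (\<lambda>i. T (p i)) \<partial>samples {..<N}) = (\<integral>S. class_sup n e S \<partial>samples {..<n})"
    unfolding c[symmetric] by (subst integral_distr[OF t, symmetric]) (auto simp: d)
qed

definition rademacher :: "nat \<Rightarrow> (nat \<Rightarrow> 'z) \<Rightarrow> real" where
  "rademacher n S = rad_exp {..<n} (\<lambda>e. class_sup n e S)"

lemma rademacher_nonneg: "0 \<le> rademacher n S"
proof -
  obtain g where g: "g \<in> F" using F_ne by auto
  have "0 = rad_exp {..<n} (\<lambda>e. \<Sum>i<n. e i * g (S i))"
    by (rule rad_exp_linear[symmetric]) simp
  also have "\<dots> \<le> rademacher n S"
    unfolding rademacher_def by (intro rad_exp_mono class_sup_upper g) auto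
  finally show ?thesis .
qed

lemma rademacher_integrable: "integrable (samples {..<n}) (rademacher n)"
  unfolding rademacher_def by (intro rad_exp_integral class_sup_integrable) auto

text \<open>Coordinates below \<open>m\<close> are the sample, those from \<open>m\<close> on the ghost sample.\<close>

definition ghost_weight :: "nat \<Rightarrow> nat \<Rightarrow> real" where
  "ghost_weight m i = (if i < m then - 1 / real m else 1 / real m)"

text \<open>A fixed sign vector is realised by a permutation of the double sample, which preserves
  its law. The supremum is then bounded by one for each half, and since \<open>e\<close> and
  \<open>- e\<close> have the same law, each half contributes one Rademacher average: hence the
  factor 2.\<close>

lemma symmetrisation:
  assumes m: "0 < m"
  shows "(\<integral>T. class_sup (2 * m) (ghost_weight m) T \<partial>samples {..<2 * m})
    \<le> 2 * (\<integral>S. rademacher m S \<partial>samples {..<m}) / real m" (is "?L \<le> _")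
proof -
  let ?R = "\<lambda>e. \<integral>S. class_sup m e S \<partial>samples {..<m}"
  have swap: "?L \<le> (?R e + ?R (\<lambda>i. - e i)) / real m" if e: "\<And>i. i < m \<Longrightarrow> e i = -1 \<or> e i = 1" for e
  proof -
    \<comment> \<open>An involution that exchanges a sample point with its ghost where
      \<open>e i = -1\<close>, so that the pair of weights at \<open>i\<close> picks up the factor
      \<open>e i\<close>.\<close>
    define p where "p i = (if i < m then (if e i = -1 then m + i else i)
        else (if e (i - m) = -1 then i - m else i))" for i
    have p: "inj_on p {..<2 * m}" "p \<in> {..<2 * m} \<rightarrow> {..<2 * m}"
      by (auto simp: p_def inj_on_def split: if_splits)
    have q: "inj_on ((+) m) {..<m}" "(+) m \<in> {..<m} \<rightarrow> {..<2 * m}"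
      "inj_on (\<lambda>i. i) {..<m}" "(\<lambda>i. i) \<in> {..<m} \<rightarrow> {..<2 * m}"
      by auto
    have "?L = (\<integral>T. class_sup (2 * m) (ghost_weight m) (\<lambda>i. T (p i)) \<partial>samples {..<2 * m})"
      by (rule class_sup_reindex(2)[OF p, symmetric])
    also have "\<dots> \<le> (\<integral>T. (class_sup m e (\<lambda>i. T (m + i)) + class_sup m (\<lambda>i. - e i) (\<lambda>i. T i)) / real m
        \<partial>samples {..<2 * m})"
    proof (intro integral_mono class_sup_reindex(1) p integrable_divide_zero Bochner_Integration.integrable_add q)
      fix T
      show "class_sup (2 * m) (ghost_weight m) (\<lambda>i. T (p i))
          \<le> (class_sup m e (\<lambda>i. T (m + i)) + class_sup m (\<lambda>i. - e i) (\<lambda>i. T i)) / real m"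
      proof (rule class_sup_least)
        fix g assume g: "g \<in> F"
        have "(\<Sum>i<2 * m. ghost_weight m i * g (T (p i))) =
            (\<Sum>i<m. ghost_weight m i * g (T (p i)) + ghost_weight m (m + i) * g (T (p (m + i))))"
          by (rule sum_lessThan_double)
        also have "\<dots> = (\<Sum>i<m. (e i * g (T (m + i)) + - e i * g (T i)) / real m)"
        proof (rule sum.cong)
          fix i assume "i \<in> {..<m}"
          then show "ghost_weight m i * g (T (p i)) + ghost_weight m (m + i) * g (T (p (m + i)))
              = (e i * g (T (m + i)) + - e i * g (T i)) / real m"
            using e[of i] by (auto simp: ghost_weight_def p_def diff_divide_distrib)
        qed simp
        also have "\<dots> = ((\<Sum>i<m. e i * g (T (m + i))) + (\<Sum>i<m. - e i * g (T i))) / real m"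
          by (simp only: sum_divide_distrib[symmetric] sum.distrib)
        also have "\<dots> \<le> (class_sup m e (\<lambda>i. T (m + i)) + class_sup m (\<lambda>i. - e i) (\<lambda>i. T i)) / real m"
          by (intro divide_right_mono add_mono class_sup_upper g) auto
        finally show "(\<Sum>i<2 * m. ghost_weight m i * g (T (p i)))
            \<le> (class_sup m e (\<lambda>i. T (m + i)) + class_sup m (\<lambda>i. - e i) (\<lambda>i. T i)) / real m" .
      qed
    qed
    also have "\<dots> = (?R e + ?R (\<lambda>i. - e i)) / real m"
      using class_sup_reindex[OF q(1,2)] class_sup_reindex[OF q(3,4)] by simp
    finally show ?thesis .
  qed
  have "?L = rad_exp {..<m} (\<lambda>e. ?L)" by simp
  also have "\<dots> \<le> rad_exp {..<m} (\<lambda>e. (?R e + ?R (\<lambda>i. - e i)) / real m)"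
    using rad_pmf_values[of "{..<m}"]
    by (intro integral_mono_AE integrable_rad_pmf AE_pmfI swap) auto
  also have "\<dots> = 2 * rad_exp {..<m} ?R / real m"
    using rad_exp_uminus[of "{..<m}" ?R] by (simp add: rad_exp_add)
  also have "rad_exp {..<m} ?R = (\<integral>S. rademacher m S \<partial>samples {..<m})"
    unfolding rademacher_def by (rule rad_exp_integral(2)[symmetric]) (auto intro: class_sup_integrable)
  finally show ?thesis .
qed

text \<open>\<open>ghost_sup\<close> is a measurable upper bound for \<open>SUP g. E g - avg g\<close>, whose own measurability
  does not follow from \<open>sup_measurable\<close>.\<close>

definition ghost_sup :: "nat \<Rightarrow> (nat \<Rightarrow> 'z) \<Rightarrow> real" where
  "ghost_sup m S = (\<integral>S'. class_sup (2 * m) (ghost_weight m) (merge {..<m} {m..<2 * m} (S, S'))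
     \<partial>samples {m..<2 * m})"

section \<open>Regularity of the ghost supremum\<close>

lemma double_interval: "{..<m} \<union> {m..<2 * m} = {..<2 * m :: nat}"
  by auto

lemma ghost_integrand_measurable:
  "(\<lambda>(S, S'). class_sup (2 * m) e (merge {..<m} {m..<2 * m} (S, S')))
    \<in> borel_measurable (samples {..<m} \<Otimes>\<^sub>M samples {m..<2 * m})"
proof -
  have "merge {..<m} {m..<2 * m} \<in> samples {..<m} \<Otimes>\<^sub>M samples {m..<2 * m} \<rightarrow>\<^sub>M samples {..<2 * m}"
    using measurable_merge[of "{..<m}" "{m..<2 * m}" "\<lambda>_. D"] by (simp only: double_interval)
  from measurable_compose[OF this class_sup_measurable[of "2 * m" e]] show ?thesis
    by (simp add: case_prod_beta')
qed

lemma ghost_sup_measurable: "ghost_sup m \<in> borel_measurable (samples {..<m})"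
proof -
  interpret P: prob_space "samples {m..<2 * m}" by (rule prob_space_samples)
  show ?thesis
    unfolding ghost_sup_def by (rule P.borel_measurable_lebesgue_integral[OF ghost_integrand_measurable])
qed

lemma ghost_integrable:
  assumes "S \<in> space (samples {..<m})"
  shows "integrable (samples {m..<2 * m}) (\<lambda>S'. class_sup (2 * m) e (merge {..<m} {m..<2 * m} (S, S')))"
proof -
  interpret P: prob_space "samples {m..<2 * m}" by (rule prob_space_samples)
  have "(\<lambda>S'. class_sup (2 * m) e (merge {..<m} {m..<2 * m} (S, S'))) \<in> borel_measurable (samples {m..<2 * m})"
    using measurable_compose_Pair1[OF assms ghost_integrand_measurable[of m e]] by simp
  then show ?thesis
    using class_sup_bound by (intro P.integrable_const_bound[of _ "(\<Sum>i<2 * m. \<bar>e i\<bar>) * M"]) auto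
qed

lemma integral_ghost_sup:
  "(\<integral>S. ghost_sup m S \<partial>samples {..<m}) = (\<integral>T. class_sup (2 * m) (ghost_weight m) T \<partial>samples {..<2 * m})"
  unfolding ghost_sup_def using class_sup_integrable[of "2 * m" "ghost_weight m"]
  by (subst PF.product_integral_fold[symmetric]) (auto simp: double_interval)

text \<open>\<open>S\<close> is not confined to the product space, so the integrand may fail to be
  integrable; its integral is then 0 by convention, which also obeys the bound.\<close>

lemma ghost_sup_bound: "\<bar>ghost_sup m S\<bar> \<le> (\<Sum>i<2 * m. \<bar>ghost_weight m i\<bar>) * M"
proof -
  interpret P: prob_space "samples {m..<2 * m}" by (rule prob_space_samples)
  let ?K = "(\<Sum>i<2 * m. \<bar>ghost_weight m i\<bar>) * M"
  have K: "0 \<le> ?K" using M_nonneg by (intro mult_nonneg_nonneg sum_nonneg) auto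
  show ?thesis
  proof (cases "integrable (samples {m..<2 * m})
      (\<lambda>S'. class_sup (2 * m) (ghost_weight m) (merge {..<m} {m..<2 * m} (S, S')))")
    case True
    have "\<bar>ghost_sup m S\<bar> \<le> (\<integral>S'. \<bar>class_sup (2 * m) (ghost_weight m) (merge {..<m} {m..<2 * m} (S, S'))\<bar>
        \<partial>samples {m..<2 * m})"
      unfolding ghost_sup_def by (rule integral_abs_bound)
    also have "\<dots> \<le> (\<integral>S'. ?K \<partial>samples {m..<2 * m})"
      using True class_sup_bound by (intro integral_mono) auto
    finally show ?thesis by (simp add: P.prob_space)
  next
    case False
    then show ?thesis using K by (simp add: ghost_sup_def not_integrable_integral_eq)
  qed
qed

text \<open>A true sample point carries weight \<open>- 1 / m\<close> and \<open>g\<close> lies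
  between 0 and \<open>M\<close>, so moving the point shifts every weighted sum by at most
  \<open>M / m\<close>, uniformly in the ghost sample.\<close>

lemma ghost_sup_diff:
  assumes m: "0 < m" and S: "S \<in> space (samples {..<m})" and i: "i < m" and z: "z \<in> space D"
  shows "ghost_sup m (S(i := z)) - ghost_sup m S \<le> M / real m"
proof -
  interpret P: prob_space "samples {m..<2 * m}" by (rule prob_space_samples)
  let ?c = "\<lambda>S S'. class_sup (2 * m) (ghost_weight m) (merge {..<m} {m..<2 * m} (S, S'))"
  have S': "S(i := z) \<in> space (samples {..<m})"
    using S i z by (auto simp: space_PiM PiE_def extensional_def Pi_def)
  have step: "?c (S(i := z)) S' - ?c S S' \<le> M / real m" for S'
  proof -
    define T where "T = merge {..<m} {m..<2 * m} (S, S')"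
    have T': "merge {..<m} {m..<2 * m} (S(i := z), S') = T(i := z)"
      using i by (auto simp: T_def merge_def fun_eq_iff)
    have "class_sup (2 * m) (ghost_weight m) (T(i := z)) \<le> class_sup (2 * m) (ghost_weight m) T + M / real m"
    proof (rule class_sup_least)
      fix g assume g: "g \<in> F"
      have "(\<Sum>j<2 * m. ghost_weight m j * g ((T(i := z)) j)) - (\<Sum>j<2 * m. ghost_weight m j * g (T j)) =
          (\<Sum>j<2 * m. if j = i then ghost_weight m i * (g z - g (T i)) else 0)"
        unfolding sum_subtractf[symmetric] by (intro sum.cong) (auto simp: algebra_simps)
      also have "\<dots> = (g (T i) - g z) / real m"
        using i by (simp add: ghost_weight_def diff_divide_distrib)
      also have "\<dots> \<le> M / real m"
        using F_le[OF g, of "T i"] F_nonneg[OF g, of z] by (intro divide_right_mono) auto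
      finally show "(\<Sum>j<2 * m. ghost_weight m j * g ((T(i := z)) j))
          \<le> class_sup (2 * m) (ghost_weight m) T + M / real m"
        using class_sup_upper[OF g, of "ghost_weight m" T "2 * m"] by linarith
    qed
    then show ?thesis unfolding T' T_def[symmetric] by simp
  qed
  have "ghost_sup m (S(i := z)) - ghost_sup m S = (\<integral>S'. ?c (S(i := z)) S' - ?c S S' \<partial>samples {m..<2 * m})"
    unfolding ghost_sup_def by (rule Bochner_Integration.integral_diff[symmetric]) (intro ghost_integrable S S')+
  also have "\<dots> \<le> (\<integral>S'. M / real m \<partial>samples {m..<2 * m})"
    by (intro integral_mono Bochner_Integration.integrable_diff ghost_integrable S S' step) simp
  finally show ?thesis by (simp add: P.prob_space)
qed

text \<open>The mean of \<open>g\<close> is the expected ghost average, so the deviation is the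
  expectation of one of the sums under the supremum.\<close>

lemma deviation_le_ghost_sup:
  assumes m: "0 < m" and S: "S \<in> space (samples {..<m})" and g: "g \<in> F"
  shows "(\<integral>z. g z \<partial>D) - (\<Sum>i<m. g (S i)) / real m \<le> ghost_sup m S"
proof -
  interpret P: prob_space "samples {m..<2 * m}" by (rule prob_space_samples)
  let ?mg = "\<lambda>S'. merge {..<m} {m..<2 * m} (S, S')"
  note gm[measurable] = F_meas[OF g]
  have comp: "integrable (samples {m..<2 * m}) (\<lambda>S'. g (S' (m + i)))"
      "(\<integral>S'. g (S' (m + i)) \<partial>samples {m..<2 * m}) = (\<integral>z. g z \<partial>D)" if "i < m" for i
  proof -
    have im: "m + i \<in> {m..<2 * m}" using that by simp
    have "distr (samples {m..<2 * m}) D (\<lambda>S'. S' (m + i)) = D"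
      using im by (intro distr_PiM_component) unfold_locales
    then show "(\<integral>S'. g (S' (m + i)) \<partial>samples {m..<2 * m}) = (\<integral>z. g z \<partial>D)"
      using im by (metis integral_distr gm measurable_component_singleton)
    have "(\<lambda>S'. g (S' (m + i))) \<in> borel_measurable (samples {m..<2 * m})"
      using im by measurable
    then show "integrable (samples {m..<2 * m}) (\<lambda>S'. g (S' (m + i)))"
      using F_nonneg[OF g] F_le[OF g] by (intro P.integrable_const_bound[of _ M]) auto
  qed
  have eq: "(\<Sum>i<2 * m. ghost_weight m i * g (?mg S' i)) =
      (\<Sum>i<m. g (S' (m + i))) / real m - (\<Sum>i<m. g (S i)) / real m" for S'
  proof -
    have "(\<Sum>i<2 * m. ghost_weight m i * g (?mg S' i)) = (\<Sum>i<m. g (S' (m + i)) / real m - g (S i) / real m)"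
      unfolding sum_lessThan_double by (intro sum.cong) (auto simp: ghost_weight_def merge_def)
    then show ?thesis by (simp add: sum_subtractf sum_divide_distrib)
  qed
  have int: "integrable (samples {m..<2 * m}) (\<lambda>S'. (\<Sum>i<m. g (S' (m + i))) / real m)"
    by (intro integrable_divide_zero Bochner_Integration.integrable_sum) (simp add: comp(1))
  have "(\<integral>S'. (\<Sum>i<m. g (S' (m + i))) / real m \<partial>samples {m..<2 * m}) = (\<integral>z. g z \<partial>D)"
    using m comp by simp
  then have "(\<integral>z. g z \<partial>D) - (\<Sum>i<m. g (S i)) / real m =
      (\<integral>S'. (\<Sum>i<m. g (S' (m + i))) / real m - (\<Sum>i<m. g (S i)) / real m \<partial>samples {m..<2 * m})"
    using int by (simp add: P.prob_space)
  also have "\<dots> \<le> ghost_sup m S"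
    unfolding ghost_sup_def eq[symmetric]
    by (intro integral_mono ghost_integrable S class_sup_upper g) (use int in \<open>simp add: eq\<close>)
  finally show ?thesis .
qed

theorem uniform_deviation:
  assumes m: "0 < m" and \<delta>: "0 < \<delta>" "\<delta> < 1"
  shows "holds_with_prob (samples {..<m}) (1 - \<delta>) (\<lambda>S.
    \<forall>g\<in>F. (\<integral>z. g z \<partial>D) \<le> (\<Sum>i<m. g (S i)) / real m
      + 2 * (\<integral>S. rademacher m S \<partial>samples {..<m}) / real m + M * sqrt (ln (1 / \<delta>) / (2 * real m)))"
proof -
  let ?P = "samples {..<m}"
  interpret P: prob_space ?P by (rule prob_space_samples)
  let ?R = "2 * (\<integral>S. rademacher m S \<partial>?P) / real m"
  \<comment> \<open>With differences \<open>M / m\<close> McDiarmid's exponent is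
    \<open>- 2 * m * t^2 / M^2\<close>; this \<open>t\<close> makes it
    \<open>- ln (1 / \<delta>)\<close>.\<close>
  define t where "t = M * sqrt (ln (1 / \<delta>) / (2 * real m))"
  have R: "0 \<le> ?R"
    using rademacher_nonneg by (intro divide_nonneg_nonneg mult_nonneg_nonneg integral_nonneg_AE) auto
  have dev: "(\<integral>z. g z \<partial>D) \<le> (\<Sum>i<m. g (S i)) / real m + ?R + t"
    if "S \<in> space ?P" "ghost_sup m S \<le> ?R + t" "g \<in> F" for S g
    using deviation_le_ghost_sup[OF m that(1,3)] that(2) by linarith
  have E: "(\<integral>S. ghost_sup m S \<partial>?P) \<le> ?R"
    using symmetrisation[OF m] by (simp add: integral_ghost_sup)
  note ghost_sup_measurable[measurable]
  show ?thesis
  proof (cases "M = 0")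
    \<comment> \<open>McDiarmid's inequality needs a positive difference bound. For
      \<open>M = 0\<close> the ghost supremum vanishes and every sample is good.\<close>
    case True
    have "ghost_sup m S \<le> ?R + t" for S
      using ghost_sup_bound[of m S] R by (simp add: True t_def)
    then show ?thesis
      unfolding holds_with_prob_def
      using dev \<delta> by (intro bexI[of _ "space ?P"]) (auto simp: t_def P.prob_space)
  next
    case False
    then have M: "0 < M" using M_nonneg by simp
    have ln: "0 < ln (1 / \<delta>)" using \<delta> by simp
    then have t: "0 < t" unfolding t_def using M m by simp
    \<comment> \<open>This bad event is measurable; its complement is the witness for the inner
      probability.\<close>
    let ?B = "{S \<in> space ?P. ghost_sup m S - (\<integral>S. ghost_sup m S \<partial>?P) \<ge> t}"
    have "measure ?P ?B \<le> exp (- 2 * t\<^sup>2 / (real m * (M / real m)\<^sup>2))"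
      using M m t
      by (intro McDiarmid[where K = "(\<Sum>i<2 * m. \<bar>ghost_weight m i\<bar>) * M"]
          ghost_sup_measurable ghost_sup_diff ghost_sup_bound D.prob_space_axioms) auto
    also have "- 2 * t\<^sup>2 / (real m * (M / real m)\<^sup>2) = - ln (1 / \<delta>)"
    proof -
      have "t\<^sup>2 = M\<^sup>2 * (ln (1 / \<delta>) / (2 * real m))"
        unfolding t_def using ln by (simp add: power_mult_distrib)
      then show ?thesis
        using M m by (simp add: power_divide) (simp add: field_simps power2_eq_square)
    qed
    also have "exp (- ln (1 / \<delta>)) = \<delta>"
      using \<delta> by (simp add: ln_div)
    finally have "measure ?P ?B \<le> \<delta>" .
    moreover have "measure ?P (space ?P - ?B) = 1 - measure ?P ?B"
      by (rule P.prob_compl) measurable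
    ultimately have "1 - \<delta> \<le> measure ?P (space ?P - ?B)" by simp
    moreover have "space ?P - ?B \<in> sets ?P" by measurable
    ultimately show ?thesis
      unfolding holds_with_prob_def t_def[symmetric]
      using dev E by (intro bexI[of _ "space ?P - ?B"]) force+
  qed
qed

end

subsection \<open>Contraction for infinite classes\<close>

text \<open>\<open>eexpectation\<close> is built from lower integrals, whose monotonicity does not depend on
  measurability.\<close>

lemma eexpectation_lower_bound:
  assumes u: "integrable N u" and le: "\<And>w. w \<in> space N \<Longrightarrow> ereal (u w) \<le> f w"
  shows "ereal (\<integral>w. u w \<partial>N) \<le> eexpectation N f"
proof -
  let ?p = "\<integral>\<^sup>+ w. ennreal (u w) \<partial>N" and ?n = "\<integral>\<^sup>+ w. ennreal (- u w) \<partial>N"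
  have fin: "?p < \<infinity>" "?n < \<infinity>"
    using u by (auto simp: real_integrable_def less_top)
  have "ereal (\<integral>w. u w \<partial>N) = enn2ereal ?p - enn2ereal ?n"
    using fin unfolding real_lebesgue_integral_def[OF u]
    by (cases ?p; cases ?n) auto
  also have "\<dots> \<le> eexpectation N f"
    unfolding eexpectation_def
  proof (intro ereal_minus_mono)
    show "enn2ereal ?p \<le> enn2ereal (\<integral>\<^sup>+ w. e2ennreal (f w) \<partial>N)"
      using le by (auto intro!: nn_integral_mono e2ennreal_mono simp flip: less_eq_ennreal.rep_eq e2ennreal_ereal)
    show "enn2ereal (\<integral>\<^sup>+ w. e2ennreal (- f w) \<partial>N) \<le> enn2ereal ?n"
      using le by (auto intro!: nn_integral_mono e2ennreal_mono
          simp flip: less_eq_ennreal.rep_eq e2ennreal_ereal uminus_ereal.simps)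
  qed
  finally show ?thesis .
qed

text \<open>Dividing \<open>u\<close> by \<open>c\<close> avoids pulling a constant through
  \<open>eexpectation\<close>. For \<open>c = 0\<close> the product is 0 even where \<open>f\<close>
  is infinite, so \<open>u\<close> is nonpositive; this case arises for the multiplicative loss when
  \<open>max_loss\<close> is 0.\<close>

lemma eexpectation_lower_bound_scaled:
  assumes u: "integrable N u" and c: "0 \<le> c"
    and le: "\<And>w. w \<in> space N \<Longrightarrow> ereal (u w) \<le> ereal c * f w"
  shows "ereal (\<integral>w. u w \<partial>N) \<le> ereal c * eexpectation N f"
proof (cases "c = 0")
  case True
  then have "\<And>w. w \<in> space N \<Longrightarrow> u w \<le> 0"
    using le by (auto simp flip: zero_ereal_def)
  then have "(\<integral>w. u w \<partial>N) \<le> (\<integral>w. 0 \<partial>N)"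
    using u by (intro integral_mono) auto
  then show ?thesis using True by (simp flip: zero_ereal_def)
next
  case False
  then have c: "0 < c" using c by simp
  have "ereal (u w / c) \<le> f w" if "w \<in> space N" for w
  proof (cases "f w")
    case (real r)
    then show ?thesis using le[OF that] c by (simp add: field_simps)
  qed (use le[OF that] c in auto)
  then have "ereal (\<integral>w. u w / c \<partial>N) \<le> eexpectation N f"
    using u by (intro eexpectation_lower_bound) auto
  then have "ereal c * ereal (\<integral>w. u w / c \<partial>N) \<le> ereal c * eexpectation N f"
    using c by (intro ereal_mult_left_mono) auto
  then show ?thesis using c by simp
qed

text \<open>For a finite number of sign patterns, finitely many near-maximisers reduce an arbitrary class
  to a finite one.\<close>

lemma rademacher_comparison_SUP:
  fixes \<psi> :: "'i \<Rightarrow> 'h \<Rightarrow> real" and \<phi> :: "'b \<Rightarrow> 'h \<Rightarrow> real"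
  assumes I: "finite I" and B: "\<And>i. i \<in> I \<Longrightarrow> finite (B i)" "disjoint_family_on B I"
    and H: "H \<noteq> {}" and bdd: "\<And>e. bdd_above ((\<lambda>h. \<Sum>i\<in>I. e i * \<psi> i h) ` H)"
    and \<kappa>: "0 \<le> \<kappa>"
    and lip: "\<And>i h h'. i \<in> I \<Longrightarrow> h \<in> H \<Longrightarrow> h' \<in> H \<Longrightarrow>
      \<bar>\<psi> i h - \<psi> i h'\<bar> \<le> \<kappa> * sqrt (\<Sum>b\<in>B i. (\<phi> b h - \<phi> b h')\<^sup>2)"
  shows "ereal (rad_exp I (\<lambda>e. SUP h\<in>H. \<Sum>i\<in>I. e i * \<psi> i h))
    \<le> ereal (2 * \<kappa>) * eexpectation (rad_pmf (\<Union>i\<in>I. B i))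
        (\<lambda>e. SUP h\<in>H. ereal (\<Sum>b\<in>(\<Union>i\<in>I. B i). e b * \<phi> b h))"
proof (rule ereal_le_epsilon2)
  fix \<eta> :: real assume \<eta>: "0 < \<eta>"
  let ?A = "\<Union>i\<in>I. B i"
  let ?s = "\<lambda>e h. \<Sum>i\<in>I. e i * \<psi> i h"
  have finA: "finite ?A" using I B by auto
  have "\<exists>h\<in>H. (SUP h\<in>H. ?s e h) - \<eta> < ?s e h" for e
    using less_cSUP_iff[OF H bdd, of "(SUP h\<in>H. ?s e h) - \<eta>" e] \<eta> by auto
  then obtain k where k: "\<And>e. k e \<in> H" "\<And>e. (SUP h\<in>H. ?s e h) - \<eta> < ?s e (k e)"
    by metis
  define H' where "H' = k ` set_pmf (rad_pmf I)"
  have H': "finite H'" "H' \<noteq> {}" "H' \<subseteq> H"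
    unfolding H'_def using finite_set_rad_pmf[OF I] k(1) by (auto simp: set_pmf_not_empty)
  \<comment> \<open>The comparison lemma has Lipschitz constant 1, so \<open>\<kappa>\<close> is
    moved into \<open>\<phi>\<close>; the leading \<open>0 +\<close> is its
    \<open>U\<close>.\<close>
  let ?u = "\<lambda>e. Max ((\<lambda>h. 0 + 2 * (\<Sum>b\<in>?A. e b * (\<kappa> * \<phi> b h))) ` H')"
  have "rad_exp I (\<lambda>e. SUP h\<in>H. ?s e h) \<le> rad_exp I (\<lambda>e. Max ((\<lambda>h. 0 + ?s e h) ` H') + \<eta>)"
  proof (intro integral_mono_AE integrable_rad_pmf I AE_pmfI)
    fix e assume "e \<in> set_pmf (rad_pmf I)"
    then have "?s e (k e) \<le> Max ((\<lambda>h. 0 + ?s e h) ` H')"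
      using H'(1) by (intro Max_ge) (auto simp: H'_def)
    then show "(SUP h\<in>H. ?s e h) \<le> Max ((\<lambda>h. 0 + ?s e h) ` H') + \<eta>"
      using k(2)[of e] by linarith
  qed
  also have "\<dots> = rad_exp I (\<lambda>e. Max ((\<lambda>h. 0 + ?s e h) ` H')) + \<eta>"
    using I by (simp add: rad_exp_add)
  also have "\<dots> \<le> rad_exp ?A ?u + \<eta>"
  proof (intro add_right_mono rademacher_comparison I B H' )
    fix i h h' assume i: "i \<in> I" "h \<in> H'" "h' \<in> H'"
    have "\<kappa> * sqrt (\<Sum>b\<in>B i. (\<phi> b h - \<phi> b h')\<^sup>2) = sqrt (\<kappa>\<^sup>2 * (\<Sum>b\<in>B i. (\<phi> b h - \<phi> b h')\<^sup>2))"
      using \<kappa> by (simp add: real_sqrt_mult)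
    also have "\<kappa>\<^sup>2 * (\<Sum>b\<in>B i. (\<phi> b h - \<phi> b h')\<^sup>2) = (\<Sum>b\<in>B i. (\<kappa> * \<phi> b h - \<kappa> * \<phi> b h')\<^sup>2)"
      unfolding sum_distrib_left by (simp flip: power_mult_distrib add: right_diff_distrib)
    finally show "\<bar>\<psi> i h - \<psi> i h'\<bar> \<le> sqrt (\<Sum>b\<in>B i. (\<kappa> * \<phi> b h - \<kappa> * \<phi> b h')\<^sup>2)"
      using lip[of i h h'] i H'(3) by auto
  qed
  finally have "ereal (rad_exp I (\<lambda>e. SUP h\<in>H. ?s e h)) \<le> ereal (rad_exp ?A ?u) + ereal \<eta>"
    by simp
  also have "ereal (rad_exp ?A ?u) \<le> ereal (2 * \<kappa>) * eexpectation (rad_pmf ?A)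
        (\<lambda>e. SUP h\<in>H. ereal (\<Sum>b\<in>?A. e b * \<phi> b h))"
  proof (rule eexpectation_lower_bound_scaled[OF integrable_rad_pmf[OF finA]])
    fix e
    have "?u e \<in> (\<lambda>h. 0 + 2 * (\<Sum>b\<in>?A. e b * (\<kappa> * \<phi> b h))) ` H'"
      using H' by (intro Max_in) auto
    then obtain h where h: "h \<in> H'" "?u e = 0 + 2 * (\<Sum>b\<in>?A. e b * (\<kappa> * \<phi> b h))" by (rule imageE)
    have "ereal (?u e) = ereal (2 * \<kappa>) * ereal (\<Sum>b\<in>?A. e b * \<phi> b h)"
      unfolding h(2) by (simp add: sum_distrib_left mult_ac)
    also have "\<dots> \<le> ereal (2 * \<kappa>) * (SUP h\<in>H. ereal (\<Sum>b\<in>?A. e b * \<phi> b h))"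
      using h H'(3) \<kappa> by (intro ereal_mult_left_mono SUP_upper) auto
    finally show "ereal (?u e) \<le> ereal (2 * \<kappa>) * (SUP h\<in>H. ereal (\<Sum>b\<in>?A. e b * \<phi> b h))" .
  qed (use \<kappa> in simp)
  finally show "ereal (rad_exp I (\<lambda>e. SUP h\<in>H. ?s e h)) \<le> ereal (2 * \<kappa>) * eexpectation (rad_pmf ?A)
        (\<lambda>e. SUP h\<in>H. ereal (\<Sum>b\<in>?A. e b * \<phi> b h)) + ereal \<eta>"
    by (simp add: add_right_mono)
qed

subsection \<open>Factor graph complexity\<close>

lemma finite_output_space:
  "(\<And>k. k \<in> {1..l} \<Longrightarrow> finite (Ys k)) \<Longrightarrow> finite (output_space l Ys)"
  unfolding output_space_def by (intro finite_PiE) auto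

lemma neighbours_subset:
  "factor_graph_on l G \<Longrightarrow> neighbours G f \<subseteq> {1..l}"
  by (auto simp: factor_graph_on_def neighbours_def)

lemma finite_factor_outputs:
  assumes "factor_graph_on l G" "\<And>k. k \<in> {1..l} \<Longrightarrow> finite (Ys k)"
  shows "finite (factor_outputs Ys G f)"
  unfolding factor_outputs_def using neighbours_subset[OF assms(1), of f] assms(2)
  by (intro finite_PiE) (auto intro: finite_subset)

lemma restrict_factor_outputs:
  assumes "factor_graph_on l G" "y \<in> output_space l Ys"
  shows "restrict y (neighbours G f) \<in> factor_outputs Ys G f"
  using neighbours_subset[OF assms(1), of f] assms(2)
  by (auto simp: output_space_def factor_outputs_def)

text \<open>The labels \<open>y\<close> and \<open>y'\<close> contribute distinct coordinates of each factor unless their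
  contributions cancel, so the constant is \<open>sqrt 2\<close> and not 2. This compensates for the suboptimal
  constant in the Khintchine inequality above.\<close>

lemma factor_score_lipschitz:
  assumes fin: "\<And>k. k \<in> {1..l} \<Longrightarrow> finite (Ys k)"
    and G: "factor_graph_on l (Gr (x, y))"
    and dec: "decomposes X (output_space l Ys) Gr h hfh" "decomposes X (output_space l Ys) Gr h' hfh'"
    and x: "x \<in> X" and y: "y \<in> output_space l Ys" and y': "y' \<in> output_space l Ys"
  shows "\<bar>(h x y - h x y') - (h' x y - h' x y')\<bar> \<le> sqrt 2 * sqrt (\<Sum>f\<in>factors (Gr (x, y)).
      \<Sum>u\<in>factor_outputs Ys (Gr (x, y)) f.
        (sqrt (real (card (factors (Gr (x, y))))) * hfh f x u
          - sqrt (real (card (factors (Gr (x, y))))) * hfh' f x u)\<^sup>2)"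
proof -
  let ?G = "Gr (x, y)"
  let ?F = "factors ?G"
  let ?r = "\<lambda>y f. restrict y (neighbours ?G f)"
  define v where "v f u = hfh f x u - hfh' f x u" for f u
  define d where "d f = v f (?r y f) - v f (?r y' f)" for f
  have d2: "(d f)\<^sup>2 \<le> 2 * (\<Sum>u\<in>factor_outputs Ys ?G f. (v f u)\<^sup>2)" for f
  proof (cases "?r y f = ?r y' f")
    case True
    then show ?thesis by (simp add: d_def sum_nonneg)
  next
    case False
    have "(d f)\<^sup>2 \<le> 2 * ((v f (?r y f))\<^sup>2 + (v f (?r y' f))\<^sup>2)"
      unfolding d_def using zero_le_power2[of "v f (?r y f) + v f (?r y' f)"]
      by (simp add: power2_eq_square algebra_simps)
    also have "(v f (?r y f))\<^sup>2 + (v f (?r y' f))\<^sup>2 = (\<Sum>u\<in>{?r y f, ?r y' f}. (v f u)\<^sup>2)"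
      using False by simp
    also have "\<dots> \<le> (\<Sum>u\<in>factor_outputs Ys ?G f. (v f u)\<^sup>2)"
      using restrict_factor_outputs[OF G y] restrict_factor_outputs[OF G y'] finite_factor_outputs[OF G fin]
      by (intro sum_mono2) auto
    finally show ?thesis by simp
  qed
  have "(h x y - h x y') - (h' x y - h' x y') = (\<Sum>f\<in>?F. d f)"
    using dec x y y' unfolding decomposes_def d_def v_def by (simp add: sum_subtractf)
  then have "((h x y - h x y') - (h' x y - h' x y'))\<^sup>2 \<le> (\<Sum>f\<in>?F. (d f)\<^sup>2) * real (card ?F)"
    using sum_squared_le_sum_of_squares[of d ?F] by simp
  also have "\<dots> \<le> (\<Sum>f\<in>?F. 2 * (\<Sum>u\<in>factor_outputs Ys ?G f. (v f u)\<^sup>2)) * real (card ?F)"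
    by (intro mult_right_mono sum_mono d2) auto
  also have "\<dots> = 2 * (\<Sum>f\<in>?F. \<Sum>u\<in>factor_outputs Ys ?G f. real (card ?F) * (v f u)\<^sup>2)"
    by (simp add: sum_distrib_left mult_ac)
  also have "(\<Sum>f\<in>?F. \<Sum>u\<in>factor_outputs Ys ?G f. real (card ?F) * (v f u)\<^sup>2) =
      (\<Sum>f\<in>?F. \<Sum>u\<in>factor_outputs Ys ?G f.
        (sqrt (real (card ?F)) * hfh f x u - sqrt (real (card ?F)) * hfh' f x u)\<^sup>2)"
    by (simp add: v_def power_mult_distrib flip: right_diff_distrib)
  finally show ?thesis
    unfolding real_sqrt_mult[symmetric] by (intro real_le_rsqrt) simp
qed

lemma sum_Sigma_Sigma:
  assumes "finite J" "\<And>i. i \<in> J \<Longrightarrow> finite (F i)" "\<And>i f. i \<in> J \<Longrightarrow> f \<in> F i \<Longrightarrow> finite (W i f)"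
  shows "sum g (Sigma J (\<lambda>i. Sigma (F i) (W i))) = (\<Sum>i\<in>J. \<Sum>f\<in>F i. \<Sum>u\<in>W i f. g (i, f, u))"
proof -
  have "(\<Sum>i\<in>J. \<Sum>f\<in>F i. \<Sum>u\<in>W i f. g (i, f, u)) = (\<Sum>i\<in>J. \<Sum>p\<in>Sigma (F i) (W i). g (i, p))"
    using assms by (intro sum.cong refl) (simp add: sum.Sigma case_prod_beta')
  also have "\<dots> = sum g (Sigma J (\<lambda>i. Sigma (F i) (W i)))"
    using assms by (simp add: sum.Sigma case_prod_beta')
  finally show ?thesis by simp
qed

text \<open>The condition \<open>lip\<close> measures the change from \<open>h\<close> to
  \<open>h'\<close> only through the score differences at the example. Both margin losses depend on
  nothing else of the scorer, so one proof covers them.\<close>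

lemma rademacher_le_fg_complexity:
  fixes Gr :: "'x \<times> 'v labelling \<Rightarrow> 'f factor_graph" and loss :: "('x, 'v) scorer \<Rightarrow> 'x \<times> 'v labelling \<Rightarrow> real"
  assumes fin: "\<And>k. k \<in> {1..l} \<Longrightarrow> finite (Ys k)"
    and graph: "\<And>x y. x \<in> X \<Longrightarrow> y \<in> output_space l Ys \<Longrightarrow> factor_graph_on l (Gr (x, y))"
    and decomp: "\<And>h. h \<in> H \<Longrightarrow> decomposes X (output_space l Ys) Gr h (hf h)"
    and H: "H \<noteq> {}" and \<kappa>: "0 \<le> \<kappa>"
    and bdd: "\<And>e. bdd_above ((\<lambda>h. \<Sum>i<m. e i * loss h (S i)) ` H)"
    and lip: "\<And>h h' x y K. h \<in> H \<Longrightarrow> h' \<in> H \<Longrightarrow> x \<in> X \<Longrightarrow> y \<in> output_space l Ys \<Longrightarrow>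
      (\<And>y'. y' \<in> output_space l Ys \<Longrightarrow> \<bar>(h x y - h x y') - (h' x y - h' x y')\<bar> \<le> K) \<Longrightarrow>
      \<bar>loss h (x, y) - loss h' (x, y)\<bar> \<le> \<kappa> * K"
    and S: "\<And>i. i < m \<Longrightarrow> S i \<in> X \<times> output_space l Ys"
  shows "ereal (rad_exp {..<m} (\<lambda>e. SUP h\<in>H. \<Sum>i<m. e i * loss h (S i)) / real m)
    \<le> ereal (2 * sqrt 2 * \<kappa>) * empirical_fg_complexity Ys Gr H hf m S"
proof -
  let ?G = "\<lambda>i. Gr (S i)"
  let ?O = "\<lambda>i. factor_outputs Ys (?G i)"
  \<comment> \<open>The coordinates belonging to example \<open>i\<close>; the tag \<open>i\<close>
    keeps the blocks disjoint even if sample points repeat.\<close>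
  let ?B = "\<lambda>i. Sigma {i} (\<lambda>i. Sigma (factors (?G i)) (?O i))"
  define \<phi> where "\<phi> b h = (case b of (i, f, u) \<Rightarrow>
      sqrt (real (card (factors (?G i)))) * hf h f (fst (S i)) u)" for b h
  have G: "factor_graph_on l (?G i)" if "i < m" for i
    using graph[of "fst (S i)" "snd (S i)"] S[OF that] by auto
  have finF: "finite (factors (?G i))" if "i < m" for i
    using G[OF that] by (simp add: factor_graph_on_def)
  have finO: "finite (?O i f)" if "i < m" for i f
    using finite_factor_outputs[OF G[OF that] fin] by simp
  have index: "rademacher_index Ys Gr m S = (\<Union>i\<in>{..<m}. ?B i)"
    by (auto simp: rademacher_index_def)
  have index': "(\<Union>i\<in>{..<m}. ?B i) = Sigma {..<m} (\<lambda>i. Sigma (factors (?G i)) (?O i))"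
    by auto
  have "ereal (rad_exp {..<m} (\<lambda>e. SUP h\<in>H. \<Sum>i<m. e i * loss h (S i)))
    \<le> ereal (2 * (sqrt 2 * \<kappa>)) * eexpectation (rad_pmf (\<Union>i\<in>{..<m}. ?B i))
        (\<lambda>e. SUP h\<in>H. ereal (\<Sum>b\<in>(\<Union>i\<in>{..<m}. ?B i). e b * \<phi> b h))"
  proof (rule rademacher_comparison_SUP[OF _ _ _ H bdd])
    fix i h h' assume i: "i \<in> {..<m}" and h: "h \<in> H" "h' \<in> H"
    obtain x y where xy: "S i = (x, y)" "x \<in> X" "y \<in> output_space l Ys"
      using S[of i] i by auto
    have "(\<Sum>b\<in>?B i. (\<phi> b h - \<phi> b h')\<^sup>2) = (\<Sum>f\<in>factors (Gr (x, y)). \<Sum>u\<in>factor_outputs Ys (Gr (x, y)) f.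
        (sqrt (real (card (factors (Gr (x, y))))) * hf h f x u
          - sqrt (real (card (factors (Gr (x, y))))) * hf h' f x u)\<^sup>2)"
      using i finF[of i] finO[of i] by (subst sum_Sigma_Sigma) (auto simp: \<phi>_def xy)
    moreover have "\<bar>loss h (x, y) - loss h' (x, y)\<bar> \<le> \<kappa> * (sqrt 2 * sqrt (\<Sum>f\<in>factors (Gr (x, y)). \<Sum>u\<in>factor_outputs Ys (Gr (x, y)) f.
        (sqrt (real (card (factors (Gr (x, y))))) * hf h f x u
          - sqrt (real (card (factors (Gr (x, y))))) * hf h' f x u)\<^sup>2))"
      by (intro lip[OF h xy(2,3)]
          factor_score_lipschitz[OF fin graph[OF xy(2,3)] decomp[OF h(1)] decomp[OF h(2)] xy(2,3)])
    ultimately show "\<bar>loss h (S i) - loss h' (S i)\<bar> \<le> sqrt 2 * \<kappa> * sqrt (\<Sum>b\<in>?B i. (\<phi> b h - \<phi> b h')\<^sup>2)"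
      by (simp add: xy(1) mult_ac)
  qed (use \<kappa> finF finO in \<open>auto simp: disjoint_family_on_def intro!: finite_SigmaI\<close>)
  also have "(\<lambda>e. SUP h\<in>H. ereal (\<Sum>b\<in>(\<Union>i\<in>{..<m}. ?B i). e b * \<phi> b h)) =
      (\<lambda>e. SUP h\<in>H. ereal (\<Sum>i<m. \<Sum>f\<in>factors (?G i). \<Sum>u\<in>?O i f.
             sqrt (real (card (factors (?G i)))) * e (i, f, u) * hf h f (fst (S i)) u))"
    unfolding index' using finF finO
    by (subst sum_Sigma_Sigma) (auto simp: \<phi>_def mult_ac)
  finally have "ereal (1 / real m) * ereal (rad_exp {..<m} (\<lambda>e. SUP h\<in>H. \<Sum>i<m. e i * loss h (S i)))
    \<le> ereal (1 / real m) * (ereal (2 * (sqrt 2 * \<kappa>)) * eexpectation (rad_pmf (\<Union>i\<in>{..<m}. ?B i))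
      (\<lambda>e. SUP h\<in>H. ereal (\<Sum>i<m. \<Sum>f\<in>factors (?G i). \<Sum>u\<in>?O i f.
             sqrt (real (card (factors (?G i)))) * e (i, f, u) * hf h f (fst (S i)) u)))"
    by (intro ereal_mult_left_mono) auto
  then show ?thesis
    unfolding empirical_fg_complexity_def index rad_pmf_def by (simp add: mult_ac)
qed

theorem lipschitz_loss_bound:
  fixes D :: "('x \<times> 'v labelling) measure"
    and Gr :: "'x \<times> 'v labelling \<Rightarrow> 'f factor_graph" and loss :: "('x, 'v) scorer \<Rightarrow> 'x \<times> 'v labelling \<Rightarrow> real"
  assumes fin: "\<And>k. k \<in> {1..l} \<Longrightarrow> finite (Ys k)"
    and D: "prob_space D" and space_D: "space D = X \<times> output_space l Ys"
    and graph: "\<And>x y. x \<in> X \<Longrightarrow> y \<in> output_space l Ys \<Longrightarrow> factor_graph_on l (Gr (x, y))"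
    and decomp: "\<And>h. h \<in> H \<Longrightarrow> decomposes X (output_space l Ys) Gr h (hf h)"
    and H: "H \<noteq> {}" and \<kappa>: "0 \<le> \<kappa>"
    and loss_props: "\<And>h. h \<in> H \<Longrightarrow> loss h \<in> borel_measurable D" "\<And>h z. h \<in> H \<Longrightarrow> 0 \<le> loss h z" "\<And>h z. h \<in> H \<Longrightarrow> loss h z \<le> M"
    and sup_meas: "sup_measurable D (loss ` H)"
    and lip: "\<And>h h' x y K. h \<in> H \<Longrightarrow> h' \<in> H \<Longrightarrow> x \<in> X \<Longrightarrow> y \<in> output_space l Ys \<Longrightarrow>
      (\<And>y'. y' \<in> output_space l Ys \<Longrightarrow> \<bar>(h x y - h x y') - (h' x y - h' x y')\<bar> \<le> K) \<Longrightarrow>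
      \<bar>loss h (x, y) - loss h' (x, y)\<bar> \<le> \<kappa> * K"
    and m: "0 < m" and \<delta>: "0 < \<delta>" "\<delta> < 1"
  shows "holds_with_prob (PiM {..<m} (\<lambda>_. D)) (1 - \<delta>) (\<lambda>S. \<forall>h\<in>H.
    ereal (\<integral>z. loss h z \<partial>D) \<le> ereal ((\<Sum>i<m. loss h (S i)) / real m)
      + ereal (4 * sqrt 2 * \<kappa>) * fg_complexity D Ys Gr H hf m + ereal (M * sqrt (ln (1 / \<delta>) / (2 * real m))))"
proof -
  interpret D: prob_space D by fact
  interpret bounded_class D "loss ` H" M
    using H loss_props sup_meas by unfold_locales auto
  let ?R = "(\<integral>S. rademacher m S \<partial>samples {..<m}) / real m"
  let ?C = "fg_complexity D Ys Gr H hf m"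
  \<comment> \<open>The Rademacher average of the losses is an integrable minorant of the scaled
    complexity, whatever the measurability of the latter. Symmetrisation then doubles the constant
    \<open>2 * sqrt 2 * \<kappa>\<close>.\<close>
  have "ereal (\<integral>S. rademacher m S / real m \<partial>samples {..<m}) \<le> ereal (2 * sqrt 2 * \<kappa>) * ?C"
    unfolding fg_complexity_def
  proof (rule eexpectation_lower_bound_scaled)
    fix S assume "S \<in> space (samples {..<m})"
    then have S: "S i \<in> X \<times> output_space l Ys" if "i < m" for i
      using that by (auto simp: space_PiM PiE_iff space_D[symmetric])
    have "rademacher m S = rad_exp {..<m} (\<lambda>e. SUP h\<in>H. \<Sum>i<m. e i * loss h (S i))"
      by (simp add: rademacher_def class_sup_def image_image)
    moreover have "ereal (rad_exp {..<m} (\<lambda>e. SUP h\<in>H. \<Sum>i<m. e i * loss h (S i)) / real m)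
        \<le> ereal (2 * sqrt 2 * \<kappa>) * empirical_fg_complexity Ys Gr H hf m S"
    proof (rule rademacher_le_fg_complexity[where l = l and X = X])
      show "bdd_above ((\<lambda>h. \<Sum>i<m. e i * loss h (S i)) ` H)" for e
        using bdd_above_class[where n = m and S = S and e = e] by (simp add: image_image)
    qed (fact fin graph decomp H \<kappa> lip S)+
    ultimately show "ereal (rademacher m S / real m)
        \<le> ereal (2 * sqrt 2 * \<kappa>) * empirical_fg_complexity Ys Gr H hf m S"
      by simp
  qed (use \<kappa> rademacher_integrable in auto)
  then have "ereal 2 * ereal ?R \<le> ereal 2 * (ereal (2 * sqrt 2 * \<kappa>) * ?C)"
    by (intro ereal_mult_left_mono) auto
  then have R: "ereal (2 * ?R) \<le> ereal (4 * sqrt 2 * \<kappa>) * ?C"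
    by (simp flip: mult.assoc)
  obtain A where A: "A \<in> sets (samples {..<m})" "1 - \<delta> \<le> measure (samples {..<m}) A"
    and dev: "\<And>S h. S \<in> A \<Longrightarrow> h \<in> H \<Longrightarrow> (\<integral>z. loss h z \<partial>D) \<le> (\<Sum>i<m. loss h (S i)) / real m
      + 2 * ?R + M * sqrt (ln (1 / \<delta>) / (2 * real m))"
    using uniform_deviation[OF m \<delta>] unfolding holds_with_prob_def by auto
  have "ereal (\<integral>z. loss h z \<partial>D) \<le> ereal ((\<Sum>i<m. loss h (S i)) / real m)
      + ereal (4 * sqrt 2 * \<kappa>) * ?C + ereal (M * sqrt (ln (1 / \<delta>) / (2 * real m)))"
    if "S \<in> A" "h \<in> H" for S h
  proof -
    have "ereal (\<integral>z. loss h z \<partial>D) \<le> ereal ((\<Sum>i<m. loss h (S i)) / real m) + ereal (2 * ?R)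
        + ereal (M * sqrt (ln (1 / \<delta>) / (2 * real m)))"
      using dev[OF that] by simp
    also have "\<dots> \<le> ereal ((\<Sum>i<m. loss h (S i)) / real m)
      + ereal (4 * sqrt 2 * \<kappa>) * ?C + ereal (M * sqrt (ln (1 / \<delta>) / (2 * real m)))"
      by (intro add_mono R order_refl)
    finally show ?thesis .
  qed
  then show ?thesis
    unfolding holds_with_prob_def using A by blast
qed

subsection \<open>Margin losses\<close>

text \<open>The empty case occurs for \<open>Y - {y}\<close> with a singleton \<open>Y\<close>: both
  maxima are then the same unspecified value.\<close>

lemma abs_Max_diff_le:
  fixes f g :: "'a \<Rightarrow> real"
  assumes A: "finite A" and K: "0 \<le> K" and le: "\<And>a. a \<in> A \<Longrightarrow> \<bar>f a - g a\<bar> \<le> K"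
  shows "\<bar>Max (f ` A) - Max (g ` A)\<bar> \<le> K"
proof (cases "A = {}")
  case True
  then show ?thesis using K by simp
next
  case False
  have "Max (f ` A) \<le> Max (g ` A) + K" if le: "\<And>a. a \<in> A \<Longrightarrow> \<bar>f a - g a\<bar> \<le> K" for f g :: "'a \<Rightarrow> real"
  proof (rule Max.boundedI)
    fix r assume "r \<in> f ` A"
    then obtain a where a: "a \<in> A" "r = f a" by auto
    have "g a \<le> Max (g ` A)" using A a by auto
    then show "r \<le> Max (g ` A) + K" using le[OF a(1)] a(2) by linarith
  qed (use A False in auto)
  from this[of f g] this[of g f] le show ?thesis
    by (simp add: abs_le_iff abs_minus_commute)
qed

lemma clip_lipschitz: "\<bar>clip M r - clip M s\<bar> \<le> \<bar>r - s\<bar>"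
  by (auto simp: clip_def min_def max_def)

lemma clip_Max_ge:
  assumes "finite A" "a \<in> A" "r \<le> f a" "r \<le> M"
  shows "r \<le> clip M (Max (f ` A))"
proof -
  have "f a \<le> Max (f ` A)" using assms by auto
  then have "r \<le> Max (f ` A)" using assms(3) by linarith
  then show ?thesis using assms(4) by (auto simp: clip_def)
qed

context
  fixes Y :: "'y set" and L :: "'y \<Rightarrow> 'y \<Rightarrow> real" and \<rho> :: real
  assumes Y: "finite Y" "Y \<noteq> {}" and L_nonneg: "\<And>y y'. y \<in> Y \<Longrightarrow> y' \<in> Y \<Longrightarrow> 0 \<le> L y y'"
    and \<rho>: "0 < \<rho>"
begin

lemma loss_le_max_loss: "y \<in> Y \<Longrightarrow> y' \<in> Y \<Longrightarrow> L y y' \<le> max_loss Y L"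
proof -
  assume y: "y \<in> Y" "y' \<in> Y"
  have "{L y y' | y y'. y \<in> Y \<and> y' \<in> Y} = (\<lambda>(y, y'). L y y') ` (Y \<times> Y)" by auto
  then have "finite {L y y' | y y'. y \<in> Y \<and> y' \<in> Y}" using Y by simp
  then show ?thesis unfolding max_loss_def using y by (intro Max_ge) auto
qed

lemma max_loss_nonneg: "0 \<le> max_loss Y L"
  using Y L_nonneg loss_le_max_loss order_trans by blast

lemma margin_loss_range:
  "0 \<le> add_loss Y L \<rho> h z" "add_loss Y L \<rho> h z \<le> max_loss Y L"
  "0 \<le> mult_loss Y L \<rho> h z" "mult_loss Y L \<rho> h z \<le> max_loss Y L"
  using max_loss_nonneg by (auto simp: add_loss_def mult_loss_def clip_def split: prod.split)

text \<open>The term \<open>L y' y\<close> cancels, which leaves the slope \<open>1 / \<rho>\<close>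
  of the score difference; \<open>Max\<close> and \<open>clip\<close> do not increase
  distances.\<close>

lemma add_loss_lipschitz:
  assumes y: "y \<in> Y"
    and K: "\<And>y'. y' \<in> Y \<Longrightarrow> \<bar>(h x y - h x y') - (h' x y - h' x y')\<bar> \<le> K"
  shows "\<bar>add_loss Y L \<rho> h (x, y) - add_loss Y L \<rho> h' (x, y)\<bar> \<le> 1 / \<rho> * K"
proof -
  have K0: "0 \<le> K" using K[OF y] by simp
  have "\<bar>(L y' y - 1 / \<rho> * (h x y - h x y')) - (L y' y - 1 / \<rho> * (h' x y - h' x y'))\<bar> \<le> 1 / \<rho> * K"
    if "y' \<in> Y" for y'
  proof -
    have "(L y' y - 1 / \<rho> * (h x y - h x y')) - (L y' y - 1 / \<rho> * (h' x y - h' x y')) =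
        - (1 / \<rho> * ((h x y - h x y') - (h' x y - h' x y')))"
      by (simp only: right_diff_distrib)
    also have "\<bar>\<dots>\<bar> = 1 / \<rho> * \<bar>(h x y - h x y') - (h' x y - h' x y')\<bar>"
      using \<rho> by (simp only: abs_minus_cancel abs_mult) simp
    also have "\<dots> \<le> 1 / \<rho> * K"
      using K[OF that] \<rho> by (intro mult_left_mono) auto
    finally show ?thesis .
  qed
  then show ?thesis
    unfolding add_loss_def prod.case using Y \<rho> K0
    by (intro order_trans[OF clip_lipschitz] abs_Max_diff_le) auto
qed

text \<open>Here the score difference is multiplied by \<open>L y' y / \<rho>\<close>, whence the
  additional factor \<open>max_loss Y L\<close>.\<close>

lemma mult_loss_lipschitz:
  assumes y: "y \<in> Y"
    and K: "\<And>y'. y' \<in> Y \<Longrightarrow> \<bar>(h x y - h x y') - (h' x y - h' x y')\<bar> \<le> K"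
  shows "\<bar>mult_loss Y L \<rho> h (x, y) - mult_loss Y L \<rho> h' (x, y)\<bar> \<le> max_loss Y L / \<rho> * K"
proof -
  have K0: "0 \<le> K" using K[OF y] by simp
  have "\<bar>L y' y * (1 - 1 / \<rho> * (h x y - h x y')) - L y' y * (1 - 1 / \<rho> * (h' x y - h' x y'))\<bar>
      \<le> max_loss Y L / \<rho> * K" if "y' \<in> Y" for y'
  proof -
    have "L y' y * (1 - 1 / \<rho> * (h x y - h x y')) - L y' y * (1 - 1 / \<rho> * (h' x y - h' x y')) =
        - (L y' y / \<rho> * ((h x y - h x y') - (h' x y - h' x y')))"
      using \<rho> by (simp add: field_simps)
    also have "\<bar>\<dots>\<bar> = L y' y / \<rho> * \<bar>(h x y - h x y') - (h' x y - h' x y')\<bar>"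
      using \<rho> L_nonneg[OF that y] by (simp only: abs_minus_cancel abs_mult) simp
    also have "\<dots> \<le> max_loss Y L / \<rho> * K"
      using K[OF that] \<rho> loss_le_max_loss[OF that y] max_loss_nonneg
      by (intro mult_mono divide_right_mono) auto
    finally show ?thesis .
  qed
  then show ?thesis
    unfolding mult_loss_def prod.case using Y \<rho> K0 max_loss_nonneg
    by (intro order_trans[OF clip_lipschitz] abs_Max_diff_le) auto
qed

text \<open>A wrong prediction \<open>p\<close> is itself one of the competitors, with nonpositive
  margin, so the inner expression at \<open>p\<close> is at least \<open>L p y\<close>; clipping at
  \<open>max_loss\<close> does not cut below that. A correct prediction costs nothing.\<close>

lemma loss_le_margin_loss:
  assumes p: "is_arg_max (h x) (\<lambda>y. y \<in> Y) p" and y: "y \<in> Y" and L_refl: "L y y = 0"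
  shows "L p y \<le> add_loss Y L \<rho> h (x, y)" "L p y \<le> mult_loss Y L \<rho> h (x, y)"
proof -
  have pY: "p \<in> Y" and le: "h x y \<le> h x p"
    using p y by (auto simp: is_arg_max_def not_less)
  show "L p y \<le> add_loss Y L \<rho> h (x, y)"
  proof (cases "p = y")
    case True
    then show ?thesis using L_refl margin_loss_range(1) by simp
  next
    case False
    have "1 / \<rho> * (h x y - h x p) \<le> 0"
      using le \<rho> by (intro mult_nonneg_nonpos) auto
    then show ?thesis
      unfolding add_loss_def prod.case using False pY Y loss_le_max_loss[OF pY y]
      by (intro clip_Max_ge[where a = p]) auto
  qed
  show "L p y \<le> mult_loss Y L \<rho> h (x, y)"
  proof (cases "p = y")
    case True
    then show ?thesis using L_refl margin_loss_range(3) by simp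
  next
    case False
    have "1 / \<rho> * (h x y - h x p) \<le> 0"
      using le \<rho> by (intro mult_nonneg_nonpos) auto
    then have "L p y * 1 \<le> L p y * (1 - 1 / \<rho> * (h x y - h x p))"
      using L_nonneg[OF pY y] by (intro mult_left_mono) auto
    then show ?thesis
      unfolding mult_loss_def prod.case using False pY Y loss_le_max_loss[OF pY y]
      by (intro clip_Max_ge[where a = p]) auto
  qed
qed

text \<open>Only finitely many labels exist, so it suffices to fix the label, and each loss is then
  a maximum of finitely many measurable functions of the input.\<close>

lemma margin_loss_measurable:
  assumes h: "\<And>y. y \<in> Y \<Longrightarrow> (\<lambda>x. h x y) \<in> borel_measurable X"
  shows "add_loss Y L \<rho> h \<in> borel_measurable (X \<Otimes>\<^sub>M count_space Y)"
    "mult_loss Y L \<rho> h \<in> borel_measurable (X \<Otimes>\<^sub>M count_space Y)"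
proof -
  have [measurable]: "(\<lambda>z. h (fst z) y) \<in> borel_measurable (X \<Otimes>\<^sub>M count_space Y)" if "y \<in> Y" for y
    using h[OF that] by measurable
  have cl: "(\<lambda>z. clip M (f z)) \<in> borel_measurable N" if "f \<in> borel_measurable N"
    for M f and N :: "('x \<times> 'y) measure"
    using that unfolding clip_def by measurable
  have *: "(\<lambda>z. clip (max_loss Y L) (Max (f (snd z) z ` (Y - {snd z})))) \<in> borel_measurable (X \<Otimes>\<^sub>M count_space Y)"
    if "\<And>y y'. y \<in> Y \<Longrightarrow> y' \<in> Y \<Longrightarrow> (\<lambda>z. f y z y') \<in> borel_measurable (X \<Otimes>\<^sub>M count_space Y)" for f
    using Y that
    by (intro measurable_compose_countable'[where g = snd and I = Y
          and f = "\<lambda>y z. clip (max_loss Y L) (Max (f y z ` (Y - {y})))"] cl borel_measurable_Max)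
      (auto intro: countable_finite)
  show "add_loss Y L \<rho> h \<in> borel_measurable (X \<Otimes>\<^sub>M count_space Y)"
    unfolding add_loss_def case_prod_beta'
    by (rule *[of "\<lambda>y z y'. L y' y - 1 / \<rho> * (h (fst z) y - h (fst z) y')"]) measurable
  show "mult_loss Y L \<rho> h \<in> borel_measurable (X \<Otimes>\<^sub>M count_space Y)"
    unfolding mult_loss_def case_prod_beta'
    by (rule *[of "\<lambda>y z y'. L y' y * (1 - 1 / \<rho> * (h (fst z) y - h (fst z) y'))"]) measurable
qed

lemma prediction_loss_measurable:
  assumes "p \<in> X \<rightarrow>\<^sub>M count_space Y"
  shows "(\<lambda>z. L (p (fst z)) (snd z)) \<in> borel_measurable (X \<Otimes>\<^sub>M count_space Y)"
proof (rule measurable_compose_countable'[where g = snd and I = Y and f = "\<lambda>y z. L (p (fst z)) y"])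
  fix y
  have "(\<lambda>z. p (fst z)) \<in> X \<Otimes>\<^sub>M count_space Y \<rightarrow>\<^sub>M count_space Y"
    using assms by measurable
  then show "(\<lambda>z. L (p (fst z)) y) \<in> borel_measurable (X \<Otimes>\<^sub>M count_space Y)"
    by (rule measurable_compose) simp
qed (use Y in \<open>auto intro: countable_finite\<close>)

end

section \<open>Assembly of the two margin bounds\<close>

lemma integral_empirical:
  fixes f :: "'z \<Rightarrow> real"
  assumes "0 < m"
  shows "(\<integral>z. f z \<partial>empirical m S) = (\<Sum>i<m. f (S i)) / real m"
  using assms unfolding empirical_def by (simp add: integral_pmf_of_set lessThan_empty_iff)

theorem theorem1:
  fixes X :: "'x measure"
    and D :: "('x \<times> 'v labelling) measure"
    and l m :: nat
    and Ys :: "nat \<Rightarrow> 'v set"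
    and Y :: "'v labelling set"
    and L :: "'v labelling \<Rightarrow> 'v labelling \<Rightarrow> real"
    and M \<rho> \<delta> :: real
    and Gr :: "'x \<times> 'v labelling \<Rightarrow> 'f factor_graph"
    and H :: "('x, 'v) scorer set"
    and hf :: "('x, 'v) scorer \<Rightarrow> 'f \<Rightarrow> 'x \<Rightarrow> 'v labelling \<Rightarrow> real"
    and pred :: "('x, 'v) scorer \<Rightarrow> 'x \<Rightarrow> 'v labelling"
  assumes fin: "\<And>k. k \<in> {1..l} \<Longrightarrow> finite (Ys k)"
    and Y: "Y = output_space l Ys"
    and loss_nonneg: "\<And>y y'. y \<in> Y \<Longrightarrow> y' \<in> Y \<Longrightarrow> 0 \<le> L y y'"
    and loss_definite: "\<And>y y'. y \<in> Y \<Longrightarrow> y' \<in> Y \<Longrightarrow> L y y' = 0 \<longleftrightarrow> y = y'"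
    and M: "M = max_loss Y L"
    and D_prob: "prob_space D"
    and D_sets: "sets D = sets (X \<Otimes>\<^sub>M count_space Y)"
    and graph: "\<And>x y. x \<in> space X \<Longrightarrow> y \<in> Y \<Longrightarrow> factor_graph_on l (Gr (x, y))"
    and scorer_meas: "\<And>h y. h \<in> H \<Longrightarrow> y \<in> Y \<Longrightarrow> (\<lambda>x. h x y) \<in> borel_measurable X"
    and decomp: "\<And>h. h \<in> H \<Longrightarrow> decomposes (space X) Y Gr h (hf h)"
    and pred_argmax: "\<And>h x. h \<in> H \<Longrightarrow> x \<in> space X \<Longrightarrow> is_arg_max (h x) (\<lambda>y. y \<in> Y) (pred h x)"
    and pred_meas: "\<And>h. h \<in> H \<Longrightarrow> pred h \<in> X \<rightarrow>\<^sub>M count_space Y"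
    and add_meas: "sup_measurable D (add_loss Y L \<rho> ` H)"
    and mult_meas: "sup_measurable D (mult_loss Y L \<rho> ` H)"
    and m: "1 \<le> m"
    and \<rho>: "0 < \<rho>"
    and \<delta>: "0 < \<delta>"
  shows "(holds_with_prob (PiM {..<m} (\<lambda>_. D)) (1 - \<delta>) (\<lambda>S. \<forall>h\<in>H.
           risk D L (pred h) \<le> add_risk D Y L \<rho> h \<and>
           ereal (add_risk D Y L \<rho> h)
             \<le> ereal (add_risk (empirical m S) Y L \<rho> h)
               + ereal (4 * sqrt 2 / \<rho>) * fg_complexity D Ys Gr H hf m
               + ereal (M * sqrt (ln (1 / \<delta>) / (2 * real m))))) \<and>
         (holds_with_prob (PiM {..<m} (\<lambda>_. D)) (1 - \<delta>) (\<lambda>S. \<forall>h\<in>H.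
           risk D L (pred h) \<le> mult_risk D Y L \<rho> h \<and>
           ereal (mult_risk D Y L \<rho> h)
             \<le> ereal (mult_risk (empirical m S) Y L \<rho> h)
               + ereal (4 * sqrt 2 * M / \<rho>) * fg_complexity D Ys Gr H hf m
               + ereal (M * sqrt (ln (1 / \<delta>) / (2 * real m)))))"
proof -
  interpret D: prob_space D by fact
  have space_D: "space D = space X \<times> Y"
    using sets_eq_imp_space_eq[OF D_sets] by (simp add: space_pair_measure)
  have finY: "finite Y" using finite_output_space[OF fin] by (simp add: Y)
  \<comment> \<open>A probability space has a point, whose second component lies in
    \<open>Y\<close>.\<close>
  have neY: "Y \<noteq> {}" using D.not_empty space_D by auto
  note Yctx = finY neY loss_nonneg \<rho>
  let ?P = "PiM {..<m} (\<lambda>_. D)"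
  have m0: "0 < m" using m by simp
  have cong: "borel_measurable D = borel_measurable (X \<Otimes>\<^sub>M count_space Y)"
    by (rule measurable_cong_sets[OF D_sets refl])
  have int_pred: "integrable D (\<lambda>z. L (pred h (fst z)) (snd z))" if h: "h \<in> H" for h
    using pred_argmax[OF h] prediction_loss_measurable[where L = L, OF Yctx pred_meas[OF h]]
    by (intro D.integrable_const_bound[of _ "max_loss Y L"] AE_I2)
      (auto simp: cong space_D is_arg_max_def loss_nonneg loss_le_max_loss[where L = L, OF Yctx])
  have meas: "add_loss Y L \<rho> h \<in> borel_measurable D" "mult_loss Y L \<rho> h \<in> borel_measurable D"
    if h: "h \<in> H" for h
    using margin_loss_measurable[where L = L, OF Yctx scorer_meas[OF h]] by (simp_all add: cong)
  have int: "integrable D (add_loss Y L \<rho> h)" "integrable D (mult_loss Y L \<rho> h)" if h: "h \<in> H" for h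
    using meas[OF h]
    by (auto intro!: D.integrable_const_bound[of _ "max_loss Y L"] AE_I2
        simp: margin_loss_range[where L = L, OF Yctx])
  have risk_le: "risk D L (pred h) \<le> add_risk D Y L \<rho> h" "risk D L (pred h) \<le> mult_risk D Y L \<rho> h"
    if h: "h \<in> H" for h
  proof -
    have "L (pred h (fst z)) (snd z) \<le> add_loss Y L \<rho> h z"
      "L (pred h (fst z)) (snd z) \<le> mult_loss Y L \<rho> h z" if zD: "z \<in> space D" for z
    proof -
      obtain x y where z: "z = (x, y)" "x \<in> space X" "y \<in> Y"
        using zD space_D by auto
      have "L y y = 0" using loss_definite z by simp
      from loss_le_margin_loss[where L = L and h = h and x = x and p = "pred h x" and y = y,
          OF Yctx pred_argmax[OF h z(2)] z(3) this]
      show "L (pred h (fst z)) (snd z) \<le> add_loss Y L \<rho> h z"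
        "L (pred h (fst z)) (snd z) \<le> mult_loss Y L \<rho> h z"
        by (simp_all add: z(1))
    qed
    then show "risk D L (pred h) \<le> add_risk D Y L \<rho> h" "risk D L (pred h) \<le> mult_risk D Y L \<rho> h"
      unfolding risk_def add_risk_def mult_risk_def
      by (auto intro!: integral_mono int_pred int h)
  qed
  have trivial: "holds_with_prob ?P (1 - \<delta>) Q" if "1 \<le> \<delta> \<or> (\<forall>S. Q S)" for Q
  proof (cases "1 \<le> \<delta>")
    case True
    then show ?thesis unfolding holds_with_prob_def by (intro bexI[of _ "{}"]) auto
  next
    case False
    interpret P: prob_space ?P using D_prob by (intro prob_space_PiM) auto
    show ?thesis
      unfolding holds_with_prob_def using that False \<delta>
      by (intro bexI[of _ "space ?P"]) (auto simp: P.prob_space)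
  qed
  show ?thesis
  proof (cases "1 \<le> \<delta> \<or> H = {}")
    case True
    then show ?thesis by (intro conjI trivial) auto
  next
    case False
    then have H: "H \<noteq> {}" and \<delta>1: "\<delta> < 1" by auto
    have Mr: "0 \<le> max_loss Y L / \<rho>" "0 \<le> 1 / \<rho>"
      using max_loss_nonneg[where L = L, OF Yctx] \<rho> by auto
    have lip_add: "\<bar>add_loss Y L \<rho> h (x, y) - add_loss Y L \<rho> h' (x, y)\<bar> \<le> 1 / \<rho> * K"
      and lip_mult: "\<bar>mult_loss Y L \<rho> h (x, y) - mult_loss Y L \<rho> h' (x, y)\<bar> \<le> max_loss Y L / \<rho> * K"
      if "y \<in> output_space l Ys"
        and "\<And>y'. y' \<in> output_space l Ys \<Longrightarrow> \<bar>(h x y - h x y') - (h' x y - h' x y')\<bar> \<le> K" for h h' x y K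
      using add_loss_lipschitz[where L = L, OF Yctx, of y h x h' K] mult_loss_lipschitz[where L = L, OF Yctx, of y h x h' K] that
      by (simp_all add: Y)
    have range: "0 \<le> add_loss Y L \<rho> h z" "add_loss Y L \<rho> h z \<le> max_loss Y L"
      "0 \<le> mult_loss Y L \<rho> h z" "mult_loss Y L \<rho> h z \<le> max_loss Y L"
      if "h \<in> H" for h :: "('x, 'v) scorer" and z
      using margin_loss_range[where L = L, OF Yctx] by simp_all
    note facts = fin D_prob space_D[unfolded Y] graph[unfolded Y] decomp[unfolded Y] H Mr meas range add_meas mult_meas m0 \<delta> \<delta>1
    have "holds_with_prob ?P (1 - \<delta>) (\<lambda>S. \<forall>h\<in>H.
        ereal (\<integral>z. add_loss Y L \<rho> h z \<partial>D) \<le> ereal ((\<Sum>i<m. add_loss Y L \<rho> h (S i)) / real m)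
          + ereal (4 * sqrt 2 * (1 / \<rho>)) * fg_complexity D Ys Gr H hf m
          + ereal (max_loss Y L * sqrt (ln (1 / \<delta>) / (2 * real m))))"
    proof (rule lipschitz_loss_bound[where l = l and X = "space X"])
      fix h h' :: "('x, 'v) scorer" and x y K
      assume "y \<in> output_space l Ys"
        and "\<And>y'. y' \<in> output_space l Ys \<Longrightarrow> \<bar>(h x y - h x y') - (h' x y - h' x y')\<bar> \<le> K"
      then show "\<bar>add_loss Y L \<rho> h (x, y) - add_loss Y L \<rho> h' (x, y)\<bar> \<le> 1 / \<rho> * K"
        by (rule lip_add)
    qed (fact facts)+
    moreover have "holds_with_prob ?P (1 - \<delta>) (\<lambda>S. \<forall>h\<in>H.
        ereal (\<integral>z. mult_loss Y L \<rho> h z \<partial>D) \<le> ereal ((\<Sum>i<m. mult_loss Y L \<rho> h (S i)) / real m)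
          + ereal (4 * sqrt 2 * (max_loss Y L / \<rho>)) * fg_complexity D Ys Gr H hf m
          + ereal (max_loss Y L * sqrt (ln (1 / \<delta>) / (2 * real m))))"
    proof (rule lipschitz_loss_bound[where l = l and X = "space X"])
      fix h h' :: "('x, 'v) scorer" and x y K
      assume "y \<in> output_space l Ys"
        and "\<And>y'. y' \<in> output_space l Ys \<Longrightarrow> \<bar>(h x y - h x y') - (h' x y - h' x y')\<bar> \<le> K"
      then show "\<bar>mult_loss Y L \<rho> h (x, y) - mult_loss Y L \<rho> h' (x, y)\<bar> \<le> max_loss Y L / \<rho> * K"
        by (rule lip_mult)
    qed (fact facts)+
    ultimately show ?thesis
      using risk_le
      by (simp add: holds_with_prob_def M add_risk_def mult_risk_def integral_empirical[OF m0])
  qed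
qed

end
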